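(* Let $r\ge 2$ be an integer, let $\Gamma,\hat\Gamma\colon \mathfrak{G}^{r}\to\mathbb{R}_{\ge 0}$ be maps each of which is uniform, smooth, locally Lipschitz, continuous, and locally monotone, and let $\mathfrak{H}$ be a hereditary family of $r$-graphs. Suppose that (i) $\hat\Gamma$ is a trajectory of $\Gamma$, (ii) $\hat\Gamma$ is symmetrization-increasing, (iii) $\hat\Gamma$ is symmetrized-stable with respect to $\mathfrak{H}$, and (iv) both $\hat\Gamma$ and $\Gamma$ are vertex-extendable with respect to $\mathfrak{H}$. Then $\Gamma$ is degree-stable with respect to $\mathfrak{H}$.
   Context: An $r$-graph is a set of $r$-subsets (edges) of a finite vertex set. $\mathfrak{G}^r$ is the collection of all vertex-labeled $r$-graphs, $\mathfrak{G}^r(n)$ those with $n$ vertices. $\mathcal{H}-v$ deletes $v$ and its edges. $L_{\mathcal{H}}(v)=\{e:e\cup\{v\}\in\mathcal{H}\}$. A family $\mathfrak{H}$ is hereditary if closed under (not necessarily induced) subgraphs. For $\Gamma\colon\mathfrak{G}^r\to\mathbb{R}$: $d_{\Gamma,\mathcal{H}}(v)=\Gamma(\mathcal{H})-\Gamma(\mathcal{H}-v)$; $\delta_\Gamma(\mathcal{H})=\min_v d_{\Gamma,\mathcal{H}}(v)$; $\Gamma$-positive means $\Gamma(\mathcal{H})>0$; $\mathrm{ex}_\Gamma(n)=\max\{\Gamma(\mathcal{H}):\mathcal{H}\in\mathfrak{G}^r(n)\}$. $o(\cdot)$ is as $n\to\infty$, uniformly over the $r$-graphs involved. Uniform: $k$-uniform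 for some real $k$, i.e. for every $n$ and $\Gamma$-positive $\mathcal{H}\in\mathfrak{G}^r(n)$, $|\sum_v d_{\Gamma,\mathcal{H}}(v)-k\Gamma(\mathcal{H})|=o(\mathrm{ex}_\Gamma(n))$; then $\mathrm{exdeg}_\Gamma(n)=k\,\mathrm{ex}_\Gamma(n)/n$. Smooth: there are $\delta_\ast\in(0,1],c_\ast,C_\ast>0$ such that for all $n$ and $\delta\in[0,\delta_\ast]$, $\mathrm{ex}_\Gamma(n-\delta n)\le\mathrm{ex}_\Gamma(n)-\delta k\,\mathrm{ex}_\Gamma(n)+C_\ast\delta^{1+c_\ast}\mathrm{ex}_\Gamma(n)+o(\mathrm{ex}_\Gamma(n))$. Locally Lipschitz: there is $C>0$ with: for every $\Gamma$-positive $n$-vertex $\mathcal{H}$, induced subgraph $\mathcal{H}'$ on $n'\le n$ vertices, $v\in V(\mathcal{H}')$: $d_{\Gamma,\mathcal{H}'}(v)\ge d_{\Gamma,\mathcal{H}}(v)-\frac{C(n-n')}{n}\mathrm{exdeg}_\Gamma(n)-o(\mathrm{exdeg}_\Gamma(n))$. Continuous: for every $\varepsilon>0$ there are $\delta>0,N_0$ such that for every $\mathcal{H}$ on $n\ge N_0$ vertices and $\mathcal{H}'\subset\mathcal{H}$ with $|\mathcal{H}'|\ge|\mathcal{H}|-\delta n^r$, $\Gamma(\mathcal{H}')\ge\Gamma(\mathcal{H})-\varepsilon\,\mathrm{ex}_\Gamma(n)$. Locally monotone: $d_{\Gamma,\mathcal{H}'}(v)\le d_{\Gamma,\mathcal{H}}(v)$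 for every $\Gamma$-positive $\mathcal{H}$, subgraph $\mathcal{H}'$, $v\in V(\mathcal{H}')$. Uncovered pair $u,v$: no edge contains both. Equivalent: $L_{\mathcal{H}}(u)=L_{\mathcal{H}}(v)$. $\mathcal{H}_{u\to v}=(\mathcal{H}\setminus\{E:u\in E\})\cup\{\{u\}\cup e:e\in L_{\mathcal{H}}(v)\}$. Symmetrized: every uncovered pair is equivalent. Symmetrization-increasing: for every $\mathcal{H}$ and uncovered $u,v$, either $\Gamma(\mathcal{H})<\max\{\Gamma(\mathcal{H}_{u\to v}),\Gamma(\mathcal{H}_{v\to u})\}$ or $\Gamma(\mathcal{H})=\Gamma(\mathcal{H}_{u\to v})=\Gamma(\mathcal{H}_{v\to u})$. With respect to $\mathfrak{H}$: symmetrized-stable: every symmetrized $\Gamma$-positive $r$-graph is in $\mathfrak{H}$; degree-stable: there are $\varepsilon>0,N_0$ such that every $\mathcal{H}$ on $n\ge N_0$ vertices with $\delta_\Gamma(\mathcal{H})\ge(1-\varepsilon)\mathrm{exdeg}_\Gamma(n)$ is in $\mathfrak{H}$; vertex-extendable: there are $\varepsilon>0,N_0$ such that for $n\ge N_0$ every $n$-vertex $\mathcal{H}$ with $\delta_\Gamma(\mathcal{H})\ge(1-\varepsilon)\mathrm{exdeg}_\Gamma(n)$ and $\mathcal{H}-v\in\mathfrak{H}$ for some $v$ is in $\mathfrak{H}$. $\hat\Gamma$ is a trajectory of $\Gamma$ if $\mathrm{ex}_\Gamma(n)\ge(1-o(1))\mathrm{ex}_{\hat\Gamma}(n)$ and for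 every $\Gamma$-positive $r$-graph $\mathcal{H}$ on $n$ vertices there is a subgraph $\mathcal{H}'\subset\mathcal{H}$ with $|\mathcal{H}'|=|\mathcal{H}|-o(n^r)$ and $\hat\Gamma(\mathcal{H}')\ge\Gamma(\mathcal{H})-o(\mathrm{ex}_\Gamma(n))$.
   Formalization: Adds that exdeg_Γ(n) > 0 for infinitely many n, since for Γ = Γ̂ = 0 and the empty family all hypotheses hold but degree-stability fails; also states explicitly that the maxima defining ex_Γ(n) and ex_Γ̂(n) exist. *)

theory Defs
  imports Complex_Main "HOL-Library.Landau_Symbols"
begin

text \<open>
  A vertex-labeled hypergraph is a pair of its vertex set and its edge set; the labels come from
  an arbitrary type \<^typ>\<open>'a\<close>. The vertex set has to be recorded because isolated vertices matter
  (for instance in deleting vertices and in uncovered pairs).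
\<close>

type_synonym 'a hgraph = "'a set \<times> 'a set set"

abbreviation verts :: "'a hgraph \<Rightarrow> 'a set" where "verts H \<equiv> fst H"
abbreviation edges :: "'a hgraph \<Rightarrow> 'a set set" where "edges H \<equiv> snd H"

definition rgraphs :: "nat \<Rightarrow> 'a hgraph set" where
  "rgraphs r = {H. finite (verts H) \<and> (\<forall>e\<in>edges H. e \<subseteq> verts H \<and> card e = r)}"

definition rgraphs_on :: "nat \<Rightarrow> nat \<Rightarrow> 'a hgraph set" where
  "rgraphs_on r n = {H \<in> rgraphs r. card (verts H) = n}"

definition subgraph :: "'a hgraph \<Rightarrow> 'a hgraph \<Rightarrow> bool" where
  "subgraph H' H \<longleftrightarrow> verts H' \<subseteq> verts H \<and> edges H' \<subseteq> edges H"

definition induced :: "'a hgraph \<Rightarrow> 'a set \<Rightarrow> 'a hgraph" where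
  "induced H W = (W, {e \<in> edges H. e \<subseteq> W})"

definition del_vertex :: "'a hgraph \<Rightarrow> 'a \<Rightarrow> 'a hgraph" where
  "del_vertex H v = (verts H - {v}, {e \<in> edges H. v \<notin> e})"

text \<open>
  The members of a link are \<open>(r-1)\<close>-sets, so \<open>v \<notin> e\<close> is required; otherwise
  \<open>insert v e \<in> edges H\<close> would also admit the edges through \<open>v\<close> themselves.
\<close>

definition link :: "'a hgraph \<Rightarrow> 'a \<Rightarrow> 'a set set" where
  "link H v = {e. v \<notin> e \<and> insert v e \<in> edges H}"

definition hereditary :: "nat \<Rightarrow> 'a hgraph set \<Rightarrow> bool" where
  "hereditary r \<HH> \<longleftrightarrow>
     \<HH> \<subseteq> rgraphs r \<and> (\<forall>H\<in>\<HH>. \<forall>H'\<in>rgraphs r. subgraph H' H \<longrightarrow> H' \<in> \<HH>)"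

text \<open>
  Maps on \<open>r\<close>-graphs are total functions \<open>\<Gamma>\<close> on hypergraphs; only their values on
  \<^term>\<open>rgraphs r\<close> are ever used. The maximum defining \<open>ex_num\<close> is meaningful if
  \<open>attains_max\<close> holds. This is automatic over an infinite label type when \<open>\<Gamma>\<close> is invariant under
  isomorphism, since \<open>\<Gamma>\<close> then has only finitely many values for each \<open>n\<close>; but \<open>\<Gamma>\<close> may also depend
  on the labels. \<open>attains_max\<close> cannot hold over a finite label type.
\<close>

definition attains_max :: "nat \<Rightarrow> ('a hgraph \<Rightarrow> real) \<Rightarrow> bool" where
  "attains_max r \<Gamma> \<longleftrightarrow>
     (\<forall>n. \<exists>H\<in>rgraphs_on r n. \<forall>H'\<in>rgraphs_on r n. \<Gamma> H' \<le> \<Gamma> H)"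

definition ex_num :: "nat \<Rightarrow> ('a hgraph \<Rightarrow> real) \<Rightarrow> nat \<Rightarrow> real" where
  "ex_num r \<Gamma> n = (GREATEST x. x \<in> \<Gamma> ` rgraphs_on r n)"

definition deg :: "('a hgraph \<Rightarrow> real) \<Rightarrow> 'a hgraph \<Rightarrow> 'a \<Rightarrow> real" where
  "deg \<Gamma> H v = \<Gamma> H - \<Gamma> (del_vertex H v)"

definition min_deg :: "('a hgraph \<Rightarrow> real) \<Rightarrow> 'a hgraph \<Rightarrow> real" where
  "min_deg \<Gamma> H = Min (deg \<Gamma> H ` verts H)"

definition k_uniform :: "nat \<Rightarrow> real \<Rightarrow> ('a hgraph \<Rightarrow> real) \<Rightarrow> bool" where
  "k_uniform r k \<Gamma> \<longleftrightarrow>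
     (\<exists>f \<in> o(ex_num r \<Gamma>). \<forall>n. \<forall>H\<in>rgraphs_on r n. \<Gamma> H > 0 \<longrightarrow>
        \<bar>(\<Sum>v\<in>verts H. deg \<Gamma> H v) - k * \<Gamma> H\<bar> \<le> f n)"

text \<open>
  The remaining notions refer to the \<open>k\<close> for which \<open>\<Gamma>\<close> is \<open>k\<close>-uniform; it is passed as a parameter.
  The theorem assumes that \<open>exdeg\<close> is positive for infinitely many \<open>n\<close>: if
  \<open>exdeg r k \<Gamma>\<close> vanishes (as for \<open>\<Gamma> = 0\<close>, or for \<open>k = 0\<close>), the degree condition
  \<open>min_deg \<Gamma> H \<ge> (1 - \<epsilon>) * exdeg r k \<Gamma> n\<close> in \<open>degree_stable\<close> also admits graphs
  with \<open>\<Gamma> H = 0\<close>.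
\<close>

definition exdeg :: "nat \<Rightarrow> real \<Rightarrow> ('a hgraph \<Rightarrow> real) \<Rightarrow> nat \<Rightarrow> real" where
  "exdeg r k \<Gamma> n = k * ex_num r \<Gamma> n / real n"

text \<open>
  In \<open>smooth\<close>, \<open>m\<close> is the number \<open>n - \<delta>n\<close>, so \<open>\<delta>\<close> ranges over the values for which it is an integer.
\<close>

definition smooth :: "nat \<Rightarrow> real \<Rightarrow> ('a hgraph \<Rightarrow> real) \<Rightarrow> bool" where
  "smooth r k \<Gamma> \<longleftrightarrow>
     (\<exists>\<delta>s c C. 0 < \<delta>s \<and> \<delta>s \<le> 1 \<and> 0 < c \<and> 0 < C \<and>
       (\<exists>f \<in> o(ex_num r \<Gamma>). \<forall>n \<delta> m. 0 \<le> \<delta> \<and> \<delta> \<le> \<delta>s \<and> real m = real n - \<delta> * real n \<longrightarrow>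
          ex_num r \<Gamma> m \<le> ex_num r \<Gamma> n - \<delta> * k * ex_num r \<Gamma> n
                          + C * \<delta> powr (1 + c) * ex_num r \<Gamma> n + f n))"

definition locally_lipschitz :: "nat \<Rightarrow> real \<Rightarrow> ('a hgraph \<Rightarrow> real) \<Rightarrow> bool" where
  "locally_lipschitz r k \<Gamma> \<longleftrightarrow>
     (\<exists>C>0. \<exists>f \<in> o(exdeg r k \<Gamma>). \<forall>n. \<forall>H\<in>rgraphs_on r n. \<Gamma> H > 0 \<longrightarrow>
        (\<forall>W v. W \<subseteq> verts H \<and> v \<in> W \<longrightarrow>
           deg \<Gamma> (induced H W) v
             \<ge> deg \<Gamma> H v - C * (real n - real (card W)) / real n * exdeg r k \<Gamma> n - f n))"

definition continuous_param :: "nat \<Rightarrow> ('a hgraph \<Rightarrow> real) \<Rightarrow> bool" where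
  "continuous_param r \<Gamma> \<longleftrightarrow>
     (\<forall>\<epsilon>>0. \<exists>\<delta>>0. \<exists>N\<^sub>0. \<forall>n\<ge>N\<^sub>0. \<forall>H\<in>rgraphs_on r n. \<forall>H'\<in>rgraphs r.
        subgraph H' H \<and> real (card (edges H')) \<ge> real (card (edges H)) - \<delta> * real n ^ r \<longrightarrow>
        \<Gamma> H' \<ge> \<Gamma> H - \<epsilon> * ex_num r \<Gamma> n)"

definition locally_monotone :: "nat \<Rightarrow> ('a hgraph \<Rightarrow> real) \<Rightarrow> bool" where
  "locally_monotone r \<Gamma> \<longleftrightarrow>
     (\<forall>H\<in>rgraphs r. \<Gamma> H > 0 \<longrightarrow>
        (\<forall>H'\<in>rgraphs r. subgraph H' H \<longrightarrow> (\<forall>v\<in>verts H'. deg \<Gamma> H' v \<le> deg \<Gamma> H v)))"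

definition uncovered :: "'a hgraph \<Rightarrow> 'a \<Rightarrow> 'a \<Rightarrow> bool" where
  "uncovered H u v \<longleftrightarrow>
     u \<in> verts H \<and> v \<in> verts H \<and> u \<noteq> v \<and> (\<nexists>e. e \<in> edges H \<and> u \<in> e \<and> v \<in> e)"

definition equivalent :: "'a hgraph \<Rightarrow> 'a \<Rightarrow> 'a \<Rightarrow> bool" where
  "equivalent H u v \<longleftrightarrow> link H u = link H v"

text \<open>\<^term>\<open>symm H u v\<close> is $\mathcal{H}_{u\to v}$: the vertex \<open>u\<close> becomes a clone of \<open>v\<close>.\<close>

definition symm :: "'a hgraph \<Rightarrow> 'a \<Rightarrow> 'a \<Rightarrow> 'a hgraph" where
  "symm H u v = (verts H, (edges H - {e. u \<in> e}) \<union> {insert u e | e. e \<in> link H v})"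

definition symmetrized :: "'a hgraph \<Rightarrow> bool" where
  "symmetrized H \<longleftrightarrow> (\<forall>u v. uncovered H u v \<longrightarrow> equivalent H u v)"

definition symmetrization_increasing :: "nat \<Rightarrow> ('a hgraph \<Rightarrow> real) \<Rightarrow> bool" where
  "symmetrization_increasing r \<Gamma> \<longleftrightarrow>
     (\<forall>H\<in>rgraphs r. \<forall>u v. uncovered H u v \<longrightarrow>
        \<Gamma> H < max (\<Gamma> (symm H u v)) (\<Gamma> (symm H v u)) \<or>
        (\<Gamma> H = \<Gamma> (symm H u v) \<and> \<Gamma> H = \<Gamma> (symm H v u)))"

definition symmetrized_stable :: "nat \<Rightarrow> ('a hgraph \<Rightarrow> real) \<Rightarrow> 'a hgraph set \<Rightarrow> bool" where
  "symmetrized_stable r \<Gamma> \<HH> \<longleftrightarrow> (\<forall>H\<in>rgraphs r. symmetrized H \<and> \<Gamma> H > 0 \<longrightarrow> H \<in> \<HH>)"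

definition degree_stable :: "nat \<Rightarrow> real \<Rightarrow> ('a hgraph \<Rightarrow> real) \<Rightarrow> 'a hgraph set \<Rightarrow> bool" where
  "degree_stable r k \<Gamma> \<HH> \<longleftrightarrow>
     (\<exists>\<epsilon>>0. \<exists>N\<^sub>0. \<forall>n\<ge>N\<^sub>0. \<forall>H\<in>rgraphs_on r n.
        min_deg \<Gamma> H \<ge> (1 - \<epsilon>) * exdeg r k \<Gamma> n \<longrightarrow> H \<in> \<HH>)"

definition vertex_extendable :: "nat \<Rightarrow> real \<Rightarrow> ('a hgraph \<Rightarrow> real) \<Rightarrow> 'a hgraph set \<Rightarrow> bool" where
  "vertex_extendable r k \<Gamma> \<HH> \<longleftrightarrow>
     (\<exists>\<epsilon>>0. \<exists>N\<^sub>0. \<forall>n\<ge>N\<^sub>0. \<forall>H\<in>rgraphs_on r n.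
        min_deg \<Gamma> H \<ge> (1 - \<epsilon>) * exdeg r k \<Gamma> n \<and> (\<exists>v\<in>verts H. del_vertex H v \<in> \<HH>)
        \<longrightarrow> H \<in> \<HH>)"

text \<open>\<^term>\<open>trajectory r \<Gamma>' \<Gamma>\<close>: the map \<open>\<Gamma>'\<close> is a trajectory of \<open>\<Gamma>\<close>.\<close>

definition trajectory :: "nat \<Rightarrow> ('a hgraph \<Rightarrow> real) \<Rightarrow> ('a hgraph \<Rightarrow> real) \<Rightarrow> bool" where
  "trajectory r \<Gamma>' \<Gamma> \<longleftrightarrow>
     (\<exists>g \<in> o(\<lambda>_. 1). \<forall>n. ex_num r \<Gamma> n \<ge> (1 - g n) * ex_num r \<Gamma>' n) \<and>
     (\<exists>f \<in> o(\<lambda>n. real n ^ r). \<exists>h \<in> o(ex_num r \<Gamma>).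
        \<forall>n. \<forall>H\<in>rgraphs_on r n. \<Gamma> H > 0 \<longrightarrow>
          (\<exists>H'\<in>rgraphs r. subgraph H' H \<and>
             real (card (edges H')) \<ge> real (card (edges H)) - f n \<and>
             \<Gamma>' H' \<ge> \<Gamma> H - h n))"

end

theory Submission
  imports Defs
begin

text \<open>
  Zykov symmetrization turns a near-extremal graph for \<open>\<Gamma>h\<close> into a symmetrized one, hence into a
  member of \<open>\<HH>\<close>, without decreasing \<open>\<Gamma>h\<close>. Each step alters the edges at one vertex only,
  and every graph on the way has few vertices of small degree, so vertex extension lets one walk
  back: the high-degree part of the original graph is in \<open>\<HH>\<close>. A graph \<open>H\<close> of large minimum
  \<open>\<Gamma>\<close>-degree contains, by the trajectory property, a near-extremal graph \<open>H'\<close> for \<open>\<Gamma>h\<close> missing only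
  few edges; it lives on almost all vertices since \<open>ex_num r \<Gamma>\<close> drops by a constant factor when a
  constant fraction of the vertices is lost. Most of \<open>H'\<close> is in \<open>\<HH>\<close>. The missing edges are
  restored vertex by vertex, each time by vertex extension for \<open>\<Gamma>\<close>, and finally the remaining vertices
  of \<open>H\<close> are added one at a time.
\<close>

text \<open>The obstacle is that \<open>ex_num\<close> is not assumed monotone, positive or
  unbounded, while the argument constantly passes from \<open>n\<close> to smaller orders
  \<open>m\<close>: induced subgraphs are judged against \<open>exdeg\<close> at their own order,
  and the trajectory property may return a graph on fewer vertices. Smoothness only bounds
  \<open>ex_num\<close> at \<open>m\<close> from above, for \<open>m\<close> close to
  \<open>n\<close> and up to an error term. Since the slope \<open>k\<close> is positive, a move
  from \<open>n\<close> down to about \<open>(1 - \<delta>) * n\<close> loses a definite factor,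
  which outweighs the errors when such moves are chained; almost monotonicity, divergence and a
  constant drop at every proportional loss of vertices come from this. The same slope explains why a
  near-extremal graph has few low-degree vertices: deleting them would cost less than
  \<open>ex_num\<close> has to fall. Positivity of slope and extremal function is available only for
  \<open>\<Gamma>\<close>; for \<open>\<Gamma>h\<close> it is derived from the trajectory property.
  Constants are chosen backwards from vertex extension: its tolerance for missing vertices is split
  into equal shares, one per source of loss.\<close>

lemma smallo_eventually_le:
  fixes f g :: "nat \<Rightarrow> real"
  assumes "f \<in> o(g)" "\<eta> > 0" and "\<And>n. 0 \<le> g n"
  shows "\<forall>\<^sub>F n in sequentially. \<bar>f n\<bar> \<le> \<eta> * g n"
  using landau_o.smallD[OF assms(1,2)] assms(3) by simp

lemma eventually_le_mult_nat:
  fixes c x :: real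
  assumes "c > 0"
  shows "\<forall>\<^sub>F n in sequentially. x \<le> c * real n"
proof -
  obtain N :: nat where "x / c \<le> real N" using real_arch_simple by blast
  then have "\<forall>n\<ge>N. x \<le> c * real n"
    using assms by (auto simp: pos_divide_le_eq mult.commute intro: order_trans)
  then show ?thesis by (auto simp: eventually_sequentially)
qed

text \<open>Starting from \<open>V\<close>, discard an element of largest value again and again: the
  average never increases. The values may be negative, and the product form avoids dividing by
  \<open>card V\<close>.\<close>

lemma exists_subset_sum_le_average:
  fixes f :: "'b \<Rightarrow> real"
  assumes "finite V" "m \<le> card V"
  shows "\<exists>X\<subseteq>V. card X = m \<and> real (card V) * sum f X \<le> real m * sum f V"
  using assms(2)
proof (induction m rule: inc_induct)
  case base
  then show ?case by auto
next
  case (step m)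
  then obtain X where X: "X \<subseteq> V" "card X = Suc m"
      "real (card V) * sum f X \<le> real (Suc m) * sum f V" by blast
  have fin: "finite X" using X(1) assms(1) finite_subset by blast
  have ne: "X \<noteq> {}" using X(2) by auto
  obtain a where a: "a \<in> X" "\<And>x. x \<in> X \<Longrightarrow> f x \<le> f a"
    using Max_in[of "f ` X"] Max_ge[of "f ` X"] fin ne
    by (metis (no_types, lifting) finite_imageI imageI image_iff image_is_empty)
  have "sum f X \<le> real (Suc m) * f a"
    using sum_bounded_above[of X f "f a"] a X(2) by auto
  moreover have "sum f X = f a + sum f (X - {a})"
    using a fin by (simp add: sum.remove)
  ultimately have "real (Suc m) * sum f (X - {a}) \<le> real m * sum f X"
    by (simp add: algebra_simps)
  then have "real (card V) * (real (Suc m) * sum f (X - {a})) \<le> real (card V) * (real m * sum f X)"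
    by (intro mult_left_mono) auto
  also have "\<dots> = real m * (real (card V) * sum f X)" by simp
  also have "\<dots> \<le> real m * (real (Suc m) * sum f V)"
    using X(3) by (intro mult_left_mono) auto
  finally have "real (Suc m) * (real (card V) * sum f (X - {a})) \<le> real (Suc m) * (real m * sum f V)"
    by (simp add: mult_ac)
  then have "real (card V) * sum f (X - {a}) \<le> real m * sum f V"
    by (rule mult_left_le_imp_le) simp
  moreover have "card (X - {a}) = m" using a X(2) fin by simp
  ultimately show ?case using X(1) by (intro exI[of _ "X - {a}"]) auto
qed

section \<open>Induced subgraphs and symmetrization\<close>

lemma induced_in_rgraphs:
  "H \<in> rgraphs r \<Longrightarrow> W \<subseteq> verts H \<Longrightarrow> induced H W \<in> rgraphs r"
  by (auto simp: rgraphs_def induced_def intro: finite_subset)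

lemma induced_in_rgraphs_on:
  "H \<in> rgraphs r \<Longrightarrow> W \<subseteq> verts H \<Longrightarrow> induced H W \<in> rgraphs_on r (card W)"
  using induced_in_rgraphs[of H r W] by (auto simp: rgraphs_on_def induced_def)

lemma verts_induced [simp]: "verts (induced H W) = W"
  by (simp add: induced_def)

lemma subgraph_induced: "W \<subseteq> verts H \<Longrightarrow> subgraph (induced H W) H"
  by (auto simp: subgraph_def induced_def)

lemma subgraph_induced_mono: "W \<subseteq> S \<Longrightarrow> subgraph (induced H W) (induced H S)"
  by (auto simp: subgraph_def induced_def)

lemma del_vertex_induced: "del_vertex (induced H W) v = induced H (W - {v})"
  by (auto simp: del_vertex_def induced_def)

lemma induced_all_verts: "H \<in> rgraphs r \<Longrightarrow> induced H (verts H) = H"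
  by (auto simp: rgraphs_def induced_def prod_eq_iff)

lemma del_vertex_eq_induced: "H \<in> rgraphs r \<Longrightarrow> del_vertex H v = induced H (verts H - {v})"
  by (metis del_vertex_induced induced_all_verts)

lemma hereditaryD:
  "hereditary r \<HH> \<Longrightarrow> H \<in> \<HH> \<Longrightarrow> H' \<in> rgraphs r \<Longrightarrow> subgraph H' H \<Longrightarrow> H' \<in> \<HH>"
  by (auto simp: hereditary_def)

text \<open>The label type is infinite, but symmetrization keeps the vertex set. Fixing that set
  makes extremal choices among counterexamples possible.\<close>

lemma finite_rgraphs_with_verts: "finite {H \<in> rgraphs r. verts H = V}"
proof (cases "finite V")
  case True
  have "{H \<in> rgraphs r. verts H = V} \<subseteq> {V} \<times> Pow (Pow V)"
    by (auto simp: rgraphs_def)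
  then show ?thesis by (rule finite_subset) (use True in simp)
next
  case False
  then have "{H \<in> rgraphs r. verts H = V} = {}" by (auto simp: rgraphs_def)
  then show ?thesis by (metis finite.emptyI)
qed

section \<open>Links under symmetrization and the tie-breaking potential\<close>

lemma verts_symm [simp]: "verts (symm H u v) = verts H"
  by (simp add: symm_def)

lemma uncovered_commute: "uncovered H u v \<longleftrightarrow> uncovered H v u"
  by (auto simp: uncovered_def)

lemma symm_in_rgraphs:
  assumes "H \<in> rgraphs r" "uncovered H u v"
  shows "symm H u v \<in> rgraphs r"
proof -
  have "insert u e \<subseteq> verts H \<and> card (insert u e) = r" if e: "e \<in> link H v" for e
  proof -
    have 1: "v \<notin> e" "insert v e \<in> edges H" using e by (auto simp: link_def)
    then have 2: "u \<notin> e" using assms(2) by (auto simp: uncovered_def)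
    have 3: "insert v e \<subseteq> verts H" "card (insert v e) = r" "finite (verts H)"
      using 1 assms(1) by (auto simp: rgraphs_def)
    have "finite e" using finite_subset[OF 3(1,3)] by simp
    then show ?thesis using 1 2 3 assms(2) by (auto simp: uncovered_def)
  qed
  then show ?thesis using assms(1) by (auto simp: rgraphs_def symm_def)
qed

lemma induced_symm: "u \<notin> W \<Longrightarrow> induced (symm H u v) W = induced H W"
  by (auto simp: induced_def symm_def)

lemma in_link_iff: "e \<in> link H v \<longleftrightarrow> v \<notin> e \<and> insert v e \<in> edges H"
  by (simp add: link_def)

lemma in_edges_symm_iff:
  "E \<in> edges (symm H u v) \<longleftrightarrow> E \<in> edges H \<and> u \<notin> E \<or> (\<exists>f\<in>link H v. E = insert u f)"
  by (auto simp: symm_def)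

lemma link_symm_self:
  assumes "uncovered H u v"
  shows "link (symm H u v) u = link H v"
proof -
  have u: "u \<notin> e" if "e \<in> link H v" for e
    using that assms by (auto simp: uncovered_def link_def)
  have "e \<in> link (symm H u v) u \<longleftrightarrow> e \<in> link H v" for e
  proof
    assume "e \<in> link (symm H u v) u"
    then obtain f where "u \<notin> e" "f \<in> link H v" "insert u e = insert u f"
      by (auto simp: in_link_iff[of e "symm H u v"] in_edges_symm_iff)
    then show "e \<in> link H v" using u by (metis insert_ident)
  next
    assume "e \<in> link H v"
    then show "e \<in> link (symm H u v) u"
      using u by (auto simp: in_link_iff[of e "symm H u v"] in_edges_symm_iff)
  qed
  then show ?thesis by blast
qed

text \<open>An edge of \<open>symm H u v\<close> through \<open>u\<close> is a copy of an edge
  through \<open>v\<close>, so the link at another vertex \<open>x\<close> is read off in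
  \<open>H\<close> by replacing \<open>u\<close> with \<open>v\<close>. Sets avoiding
  \<open>u\<close> are untouched.\<close>

lemma in_link_symm:
  assumes "uncovered H u v" "x \<noteq> u"
  shows "e \<in> link (symm H u v) x \<longleftrightarrow>
    (if u \<in> e then x \<notin> e \<and> v \<notin> e \<and> v \<noteq> x \<and> insert v (e - {u}) \<in> link H x else e \<in> link H x)"
proof (cases "u \<in> e")
  case False
  then have "insert x e \<noteq> insert u f" for f using assms(2) by (metis insertE insertI1)
  then show ?thesis using False assms(2) by (simp add: in_link_iff in_edges_symm_iff)
next
  case True
  have "e \<in> link (symm H u v) x \<longleftrightarrow> x \<notin> e \<and> (\<exists>f\<in>link H v. insert x e = insert u f)"
    using True by (auto simp: in_link_iff[of _ "symm H u v"] in_edges_symm_iff)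
  also have "\<dots> \<longleftrightarrow> x \<notin> e \<and> insert x (e - {u}) \<in> link H v"
  proof -
    have "insert x e = insert u f \<longleftrightarrow> insert x (e - {u}) = f" if "f \<in> link H v" for f
    proof -
      have "u \<notin> f" using that assms by (auto simp: uncovered_def link_def)
      moreover have "e = insert u (e - {u})" using True by blast
      ultimately show ?thesis using assms(2)
        by (metis Diff_insert_absorb insert_Diff_if insert_commute singletonD)
    qed
    then show ?thesis by blast
  qed
  also have "\<dots> \<longleftrightarrow> x \<notin> e \<and> v \<notin> e \<and> v \<noteq> x \<and> insert v (e - {u}) \<in> link H x"
    unfolding in_link_iff insert_commute[of v x] using assms by (auto simp: uncovered_def)
  finally show ?thesis using True by simp
qed

text \<open>The description in \<open>in_link_symm\<close> depends on \<open>x\<close> only through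
  \<open>link H x\<close>: membership of \<open>insert v (e - {u})\<close> in that link already
  forces \<open>x\<close> to differ from \<open>v\<close> and, since \<open>x\<close> is not
  \<open>u\<close>, to lie outside \<open>e\<close>.\<close>

lemma link_symm_eq:
  assumes "uncovered H u v" "x \<noteq> u" "y \<noteq> u" "link H x = link H y"
  shows "link (symm H u v) x = link (symm H u v) y"
proof -
  have "e \<in> link (symm H u v) y"
    if "e \<in> link (symm H u v) x" "x \<noteq> u" "y \<noteq> u" "link H x = link H y" for e x y
    using that(1) unfolding in_link_symm[OF assms(1) that(2)] in_link_symm[OF assms(1) that(3)]
    using that(2-4) by (auto simp: link_def split: if_splits)
  then show ?thesis using assms(2-4) by (metis subsetI subset_antisym)
qed

lemma link_symm_target:
  assumes "uncovered H u v"
  shows "link (symm H u v) v = link H v"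
proof -
  have "v \<noteq> u" using assms by (auto simp: uncovered_def)
  moreover have "u \<notin> e" if "e \<in> link H v" for e
    using that assms by (auto simp: uncovered_def link_def)
  ultimately show ?thesis using in_link_symm[OF assms \<open>v \<noteq> u\<close>] by (auto split: if_splits)
qed

text \<open>Ordered pairs, diagonal included, so the cardinality is the sum of the squares of the
  class sizes. It serves as the potential when symmetrization leaves the parameter
  unchanged.\<close>

definition equivalent_pairs :: "'a hgraph \<Rightarrow> ('a \<times> 'a) set" where
  "equivalent_pairs H = {(x, y) \<in> verts H \<times> verts H. equivalent H x y}"

definition equivalence_class :: "'a hgraph \<Rightarrow> 'a \<Rightarrow> 'a set" where
  "equivalence_class H x = {y \<in> verts H. equivalent H x y}"

text \<open>
  Moving a vertex from a class of size \<open>a\<close> to a class of size \<open>b \<ge> a\<close> destroys at most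
  \<open>2 * (a - 1)\<close> equivalent pairs and creates \<open>2 * b\<close> new ones.
\<close>

lemma card_equivalent_pairs_symm:
  assumes fin: "finite (verts H)" and unc: "uncovered H u v" and neq: "\<not> equivalent H u v"
    and le: "card (equivalence_class H u) \<le> card (equivalence_class H v)"
  shows "card (equivalent_pairs H) < card (equivalent_pairs (symm H u v))"
proof -
  let ?H = "symm H u v" let ?Cu = "equivalence_class H u" let ?Cv = "equivalence_class H v"
  \<comment> \<open>\<open>?A\<close> collects the equivalent pairs of \<open>H\<close> that involve
    \<open>u\<close>, and \<open>?B\<close> pairs involving \<open>u\<close> that hold after
    cloning. Both contain the pair of \<open>u\<close> with itself, so their sizes are
    \<open>2 * a - 1\<close> and \<open>2 * b + 1\<close> for class sizes \<open>a\<close> and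
    \<open>b\<close>.\<close>
  let ?A = "{u} \<times> ?Cu \<union> (?Cu - {u}) \<times> {u}"
  let ?B = "{u} \<times> (insert u ?Cv) \<union> ?Cv \<times> {u}"
  have uv: "u \<in> verts H" "v \<in> verts H" "u \<noteq> v" using unc by (auto simp: uncovered_def)
  have finC: "finite ?Cu" "finite ?Cv" using fin by (auto simp: equivalence_class_def)
  have finE: "finite (equivalent_pairs H)" "finite (equivalent_pairs ?H)"
    using fin by (auto simp: equivalent_pairs_def intro: finite_subset[of _ "verts H \<times> verts H"])
  have uC: "u \<in> ?Cu" "u \<notin> ?Cv"
    using uv neq by (auto simp: equivalence_class_def equivalent_def)
  have cardA: "card ?A = card ?Cu + (card ?Cu - 1)"
    using finC uC by (subst card_Un_disjoint) (auto simp: card_cartesian_product)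
  have cardB: "card ?B = Suc (card ?Cv) + card ?Cv"
    using finC uC by (subst card_Un_disjoint) (auto simp: card_cartesian_product)
  have Cu_pos: "0 < card ?Cu" using finC uC by (auto simp: card_gt_0_iff)
  have Cv_link: "link ?H w = link ?H u" if "w \<in> ?Cv" for w
  proof -
    have "link H w = link H v" using that by (auto simp: equivalence_class_def equivalent_def)
    moreover have "w \<noteq> u" using that uC by auto
    ultimately have "link ?H w = link ?H v" using link_symm_eq[OF unc] uv by metis
    then show ?thesis using link_symm_self[OF unc] link_symm_target[OF unc] by simp
  qed
  have AE: "?A \<subseteq> equivalent_pairs H"
    using uv by (auto simp: equivalent_pairs_def equivalence_class_def equivalent_def)
  have sub1: "equivalent_pairs H - ?A \<subseteq> equivalent_pairs ?H"
  proof
    fix p assume p: "p \<in> equivalent_pairs H - ?A"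
    then obtain x y where xy: "p = (x, y)" "x \<in> verts H" "y \<in> verts H" "link H x = link H y"
      by (auto simp: equivalent_pairs_def equivalent_def)
    then have "x \<noteq> u" "y \<noteq> u"
      using p by (auto simp: equivalence_class_def equivalent_def)
    then have "link ?H x = link ?H y" using xy(4) by (intro link_symm_eq[OF unc])
    then show "p \<in> equivalent_pairs ?H"
      using xy by (simp add: equivalent_pairs_def equivalent_def)
  qed
  have sub2: "?B \<subseteq> equivalent_pairs ?H"
  proof -
    have "(u, w) \<in> equivalent_pairs ?H" "(w, u) \<in> equivalent_pairs ?H" if "w \<in> ?Cv" for w
    proof -
      have "w \<in> verts H" "link ?H w = link ?H u"
        using that Cv_link by (auto simp: equivalence_class_def)
      then show "(u, w) \<in> equivalent_pairs ?H" "(w, u) \<in> equivalent_pairs ?H"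
        using uv(1) by (simp_all add: equivalent_pairs_def equivalent_def)
    qed
    moreover have "(u, u) \<in> equivalent_pairs ?H"
      using uv(1) by (simp add: equivalent_pairs_def equivalent_def)
    ultimately show ?thesis by auto
  qed
  have disj: "(equivalent_pairs H - ?A) \<inter> ?B = {}"
  proof -
    have "fst p \<noteq> u \<and> snd p \<noteq> u" if "p \<in> equivalent_pairs H - ?A" for p
      using that by (cases p) (auto simp: equivalent_pairs_def equivalence_class_def equivalent_def)
    moreover have "fst p = u \<or> snd p = u" if "p \<in> ?B" for p using that by auto
    ultimately show ?thesis by blast
  qed
  have "finite ?A" "finite ?B" using finC by auto
  then have "card ((equivalent_pairs H - ?A) \<union> ?B) = card (equivalent_pairs H) - card ?A + card ?B"
    using disj finE(1) AE by (simp only: card_Un_disjoint finite_Diff card_Diff_subset)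
  moreover have "card ((equivalent_pairs H - ?A) \<union> ?B) \<le> card (equivalent_pairs ?H)"
    by (rule card_mono[OF finE(2) Un_least[OF sub1 sub2]])
  moreover have "card ?A \<le> card (equivalent_pairs H)" by (rule card_mono[OF finE(1) AE])
  ultimately show ?thesis unfolding cardA cardB using Cu_pos le by arith
qed

section \<open>Growth of the extremal function\<close>

locale hgraph_parameter =
  fixes r :: nat and k :: real and \<Gamma> :: "'a hgraph \<Rightarrow> real"
  assumes nonneg: "H \<in> rgraphs r \<Longrightarrow> 0 \<le> \<Gamma> H"
    and attains: "attains_max r \<Gamma>"
    and uniform: "k_uniform r k \<Gamma>"
    and smooth: "smooth r k \<Gamma>"
    and lipschitz: "locally_lipschitz r k \<Gamma>"
    and monotone: "locally_monotone r \<Gamma>"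
begin

abbreviation extr :: "nat \<Rightarrow> real" where "extr \<equiv> ex_num r \<Gamma>"

lemma extr_attained: "\<exists>H\<in>rgraphs_on r n. \<Gamma> H = extr n \<and> (\<forall>H'\<in>rgraphs_on r n. \<Gamma> H' \<le> extr n)"
proof -
  obtain H where H: "H \<in> rgraphs_on r n" "\<forall>H'\<in>rgraphs_on r n. \<Gamma> H' \<le> \<Gamma> H"
    using attains unfolding attains_max_def by metis
  then have "extr n = \<Gamma> H" unfolding ex_num_def by (intro Greatest_equality) auto
  with H show ?thesis by metis
qed

lemma le_extr: "H \<in> rgraphs_on r n \<Longrightarrow> \<Gamma> H \<le> extr n"
  using extr_attained by blast

lemma extr_nonneg: "0 \<le> extr n"
  using extr_attained[of n] nonneg unfolding rgraphs_on_def by (metis (no_types, lifting) mem_Collect_eq)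

text \<open>The error term of smoothness is superlinear in the lost fraction, so on a short enough
  window it is paid for by lowering the slope from \<open>k\<close> to \<open>\<kappa>\<close>. The
  window does not depend on \<open>\<eta>\<close>, which only absorbs the little-o term.\<close>

lemma smooth_slope:
  assumes "\<kappa> < k"
  obtains \<delta> where "0 < \<delta>" "\<delta> < 1"
    "\<And>\<eta>. 0 < \<eta> \<Longrightarrow> \<forall>\<^sub>F n in sequentially. \<forall>m\<le>n. (1 - \<delta>) * real n \<le> real m \<longrightarrow>
        extr m \<le> (1 - (1 - real m / real n) * \<kappa> + \<eta>) * extr n"
proof -
  obtain \<delta>s c C f where sm: "0 < \<delta>s" "\<delta>s \<le> 1" "0 < c" "0 < C" "f \<in> o(extr)"
    "\<And>n \<delta> m. 0 \<le> \<delta> \<Longrightarrow> \<delta> \<le> \<delta>s \<Longrightarrow> real m = real n - \<delta> * real n \<Longrightarrow>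
       extr m \<le> extr n - \<delta> * k * extr n + C * \<delta> powr (1 + c) * extr n + f n"
    using smooth unfolding smooth_def by metis
  \<comment> \<open>The solution of \<open>C * q powr c = k - \<kappa>\<close>; for fractions up to
    \<open>q\<close> the superlinear term is at most the slope difference.\<close>
  define q where "q = ((k - \<kappa>) / C) powr (1 / c)"
  define \<delta> where "\<delta> = min (min \<delta>s (1/2)) q"
  have q: "0 < q" "q powr c = (k - \<kappa>) / C"
    using sm assms by (auto simp: q_def powr_powr)
  have \<delta>: "0 < \<delta>" "\<delta> < 1" "\<delta> \<le> \<delta>s" "\<delta> \<le> q" using q sm by (auto simp: \<delta>_def)
  show thesis
  proof (rule that[OF \<delta>(1,2)])
    fix \<eta> :: real assume \<eta>: "0 < \<eta>"
    have "\<forall>\<^sub>F n in sequentially. \<bar>f n\<bar> \<le> \<eta> * extr n"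
      using smallo_eventually_le[OF sm(5) \<eta>] extr_nonneg by blast
    then show "\<forall>\<^sub>F n in sequentially. \<forall>m\<le>n. (1 - \<delta>) * real n \<le> real m \<longrightarrow>
        extr m \<le> (1 - (1 - real m / real n) * \<kappa> + \<eta>) * extr n"
      using eventually_gt_at_top[of 0]
    proof eventually_elim
      case (elim n)
      show ?case
      proof (intro allI impI)
        fix m assume m: "m \<le> n" "(1 - \<delta>) * real n \<le> real m"
        define d where "d = 1 - real m / real n"
        have d: "0 \<le> d" "d \<le> \<delta>" "real m = real n - d * real n"
          using m elim by (auto simp: d_def field_simps)
        have "C * d powr (1 + c) \<le> d * (k - \<kappa>)"
        proof (cases "d = 0")
          case False
          then have "d powr (1 + c) = d * d powr c" using d by (simp add: powr_add)
          moreover have "d powr c \<le> (k - \<kappa>) / C"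
            using powr_mono2[of c d q] d \<delta> sm q by auto
          then have "d * (C * d powr c) \<le> d * (k - \<kappa>)"
            using d sm by (intro mult_left_mono) (auto simp: field_simps)
          ultimately show ?thesis by (simp add: mult_ac)
        qed auto
        then have "C * d powr (1 + c) * extr n \<le> d * (k - \<kappa>) * extr n"
          using extr_nonneg by (intro mult_right_mono) auto
        moreover have "extr m \<le> extr n - d * k * extr n + C * d powr (1 + c) * extr n + f n"
          using sm(6) d \<delta> by auto
        ultimately have "extr m \<le> (1 - d * \<kappa> + \<eta>) * extr n"
          using elim by (simp add: algebra_simps)
        then show "extr m \<le> (1 - (1 - real m / real n) * \<kappa> + \<eta>) * extr n" by (simp add: d_def)
      qed
    qed
  qed
qed

text \<open>For large \<open>n\<close> the predecessor of \<open>n\<close> lies in the window, so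
  \<open>extr (n - 1)\<close> is at most a multiple of \<open>extr n\<close> and positivity passes
  from each order to the next. The sign of \<open>k\<close> is unknown here, hence the slope
  \<open>k - 1\<close>.\<close>

lemma extr_eventually_pos:
  assumes "\<exists>\<^sub>F n in sequentially. 0 < extr n"
  shows "\<forall>\<^sub>F n in sequentially. 0 < extr n"
proof -
  have "k - 1 < k" by simp
  then obtain \<delta> where \<delta>: "0 < \<delta>" and
    slope: "\<And>\<eta>. 0 < \<eta> \<Longrightarrow> \<forall>\<^sub>F n in sequentially. \<forall>m\<le>n. (1 - \<delta>) * real n \<le> real m \<longrightarrow>
        extr m \<le> (1 - (1 - real m / real n) * (k - 1) + \<eta>) * extr n"
    using smooth_slope by blast
  have "\<forall>\<^sub>F n in sequentially. \<forall>m\<le>n. real n - 1 \<le> real m \<longrightarrow> 0 < extr m \<longrightarrow> 0 < extr n"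
    using slope[OF zero_less_one] eventually_le_mult_nat[OF \<delta>, of 1]
  proof eventually_elim
    case (elim n)
    show ?case
    proof (intro allI impI)
      fix m assume m: "m \<le> n" "real n - 1 \<le> real m" "0 < extr m"
      then have "(1 - \<delta>) * real n \<le> real m" using elim by (simp add: algebra_simps)
      then have "0 < (1 - (1 - real m / real n) * (k - 1) + 1) * extr n"
        using elim(1) m by (metis less_le_trans)
      then show "0 < extr n" using extr_nonneg[of n] by (cases "extr n = 0") auto
    qed
  qed
  then obtain N where N: "\<And>n m. n \<ge> N \<Longrightarrow> m \<le> n \<Longrightarrow> real n - 1 \<le> real m \<Longrightarrow> 0 < extr m \<Longrightarrow> 0 < extr n"
    unfolding eventually_sequentially by blast
  obtain n0 where n0: "n0 \<ge> N" "0 < extr n0"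
    using assms unfolding frequently_sequentially by blast
  have "0 < extr n" if "n \<ge> n0" for n
    using that
  proof (induction n rule: dec_induct)
    case (step n)
    then show ?case using N[of "Suc n" n] n0 by auto
  qed (use n0 in auto)
  then show ?thesis unfolding eventually_sequentially by blast
qed

text \<open>Delete the vertices of \<open>X\<close> one at a time. By local monotonicity each
  deletion costs at most the original degree in \<open>H\<close>; only \<open>H\<close> itself has
  to be positive for this.\<close>

lemma \<Gamma>_diff_ge:
  assumes "H \<in> rgraphs r" "0 < \<Gamma> H" "X \<subseteq> verts H"
  shows "\<Gamma> H - (\<Sum>x\<in>X. deg \<Gamma> H x) \<le> \<Gamma> (induced H (verts H - X))"
proof -
  have "finite (verts H)" using assms(1) by (auto simp: rgraphs_def)
  then have "finite X" using assms(3) finite_subset by blast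
  then show ?thesis using assms(3)
  proof (induction X rule: finite_induct)
    case empty
    then show ?case using assms(1) by (simp add: induced_all_verts)
  next
    case (insert x X)
    let ?I = "induced H (verts H - X)"
    have "?I \<in> rgraphs r" "subgraph ?I H"
      using assms(1) by (auto intro: induced_in_rgraphs subgraph_induced)
    then have "deg \<Gamma> ?I x \<le> deg \<Gamma> H x"
      using monotone assms(1,2) insert by (auto simp: locally_monotone_def)
    moreover have "del_vertex ?I x = induced H (verts H - insert x X)"
      by (simp add: del_vertex_induced set_diff_eq) (metis)
    ultimately show ?case using insert by (auto simp: deg_def)
  qed
qed

end

text \<open>Kept apart from \<open>hgraph_parameter\<close> because for \<open>\<Gamma>h\<close>
  these two facts are conclusions, drawn from results that already need the weaker locale.\<close>

locale pos_hgraph_parameter = hgraph_parameter +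
  assumes k_pos: "0 < k"
    and extr_frequently_pos: "\<exists>\<^sub>F n in sequentially. 0 < extr n"
begin

lemmas extr_pos = extr_eventually_pos[OF extr_frequently_pos]

lemma extr_drop_window:
  obtains \<delta> \<gamma> where "0 < \<delta>" "\<delta> < 1" "0 < \<gamma>" "\<gamma> < 1"
    "\<forall>\<^sub>F n in sequentially. \<forall>m. (1 - \<delta>) * real n \<le> real m \<longrightarrow> real m \<le> (1 - \<delta> / 2) * real n \<longrightarrow>
        extr m \<le> (1 - \<gamma>) * extr n"
    "\<forall>\<eta>>0. \<forall>\<^sub>F n in sequentially. \<forall>m\<le>n. (1 - \<delta>) * real n \<le> real m \<longrightarrow>
        extr m \<le> (1 + \<eta>) * extr n"
proof -
  have "k / 2 < k" using k_pos by simp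
  then obtain \<delta> where \<delta>: "0 < \<delta>" "\<delta> < 1" and
    slope: "\<And>\<eta>. 0 < \<eta> \<Longrightarrow> \<forall>\<^sub>F n in sequentially. \<forall>m\<le>n. (1 - \<delta>) * real n \<le> real m \<longrightarrow>
        extr m \<le> (1 - (1 - real m / real n) * (k / 2) + \<eta>) * extr n"
    using smooth_slope by blast
  \<comment> \<open>On the window at least the fraction \<open>\<delta> / 2\<close> is lost, which
    at slope \<open>k / 2\<close> lowers the factor by \<open>\<delta> * k / 4\<close>. Half of this
    pays for the error \<open>\<gamma>\<close>, the other half is the gain.\<close>
  define \<gamma> where "\<gamma> = min (\<delta> * k / 8) (1 / 2)"
  have \<gamma>: "0 < \<gamma>" "\<gamma> < 1" "\<gamma> \<le> \<delta> * k / 8" using \<delta> k_pos by (auto simp: \<gamma>_def)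
  show thesis
  proof (rule that[OF \<delta> \<gamma>(1,2)])
    show "\<forall>\<^sub>F n in sequentially. \<forall>m. (1 - \<delta>) * real n \<le> real m \<longrightarrow> real m \<le> (1 - \<delta> / 2) * real n \<longrightarrow>
        extr m \<le> (1 - \<gamma>) * extr n"
      using slope[OF \<gamma>(1)] eventually_gt_at_top[of 0]
    proof eventually_elim
      case (elim n)
      show ?case
      proof (intro allI impI)
        fix m assume m: "(1 - \<delta>) * real n \<le> real m" "real m \<le> (1 - \<delta> / 2) * real n"
        have "(1 - \<delta> / 2) * real n \<le> 1 * real n" using \<delta> by (intro mult_right_mono) auto
        then have "m \<le> n" using m(2) by simp
        then have "extr m \<le> (1 - (1 - real m / real n) * (k / 2) + \<gamma>) * extr n"
          using elim(1) m(1) by blast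
        also have "\<dots> \<le> (1 - \<gamma>) * extr n"
        proof (intro mult_right_mono extr_nonneg)
          have "\<delta> / 2 \<le> 1 - real m / real n" using m elim by (simp add: field_simps)
          then have "\<delta> / 2 * (k / 2) \<le> (1 - real m / real n) * (k / 2)"
            using k_pos by (intro mult_right_mono) auto
          then show "1 - (1 - real m / real n) * (k / 2) + \<gamma> \<le> 1 - \<gamma>" using \<gamma>(3) by linarith
        qed
        finally show "extr m \<le> (1 - \<gamma>) * extr n" .
      qed
    qed
    show "\<forall>\<eta>>0. \<forall>\<^sub>F n in sequentially. \<forall>m\<le>n. (1 - \<delta>) * real n \<le> real m \<longrightarrow>
        extr m \<le> (1 + \<eta>) * extr n"
    proof (intro allI impI)
      fix \<eta> :: real assume \<eta>: "0 < \<eta>"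
      show "\<forall>\<^sub>F n in sequentially. \<forall>m\<le>n. (1 - \<delta>) * real n \<le> real m \<longrightarrow>
        extr m \<le> (1 + \<eta>) * extr n"
        using slope[OF \<eta>] eventually_gt_at_top[of 0]
      proof eventually_elim
        case (elim n)
        show ?case
        proof (intro allI impI)
          fix m assume m: "m \<le> n" "(1 - \<delta>) * real n \<le> real m"
          have "0 \<le> (1 - real m / real n) * (k / 2)"
            using m elim k_pos by (auto simp: field_simps)
          then have "(1 - (1 - real m / real n) * (k / 2) + \<eta>) * extr n \<le> (1 + \<eta>) * extr n"
            by (intro mult_right_mono extr_nonneg) auto
          then show "extr m \<le> (1 + \<eta>) * extr n" using elim m by force
        qed
      qed
    qed
  qed
qed

text \<open>Strong induction on \<open>n\<close>: if \<open>m\<close> lies below the window of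
  \<open>n\<close>, hop to an \<open>l\<close> near \<open>(1 - \<delta>) * n\<close>. Every such
  hop gains a factor \<open>1 - \<gamma>\<close>, so errors do not accumulate and only the last,
  short hop costs \<open>1 + \<eta>'\<close>.\<close>

lemma extr_almost_mono_above:
  assumes "0 < \<eta>"
  shows "\<exists>N. \<forall>n m. N \<le> m \<longrightarrow> m \<le> n \<longrightarrow> extr m \<le> (1 + \<eta>) * extr n"
proof -
  obtain \<delta> \<gamma> where \<delta>: "0 < \<delta>" "\<delta> < 1" "0 < \<gamma>" "\<gamma> < 1" and
    drop: "\<forall>\<^sub>F n in sequentially. \<forall>m. (1 - \<delta>) * real n \<le> real m \<longrightarrow> real m \<le> (1 - \<delta> / 2) * real n \<longrightarrow>
        extr m \<le> (1 - \<gamma>) * extr n" and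
    near: "\<forall>\<eta>>0. \<forall>\<^sub>F n in sequentially. \<forall>m\<le>n. (1 - \<delta>) * real n \<le> real m \<longrightarrow>
        extr m \<le> (1 + \<eta>) * extr n"
    using extr_drop_window by blast
  define \<eta>' where "\<eta>' = min \<eta> \<gamma>"
  have \<eta>': "0 < \<eta>'" "\<eta>' \<le> \<eta>" "\<eta>' \<le> \<gamma>" using assms \<delta> by (auto simp: \<eta>'_def)
  obtain N where N: "\<And>n. n \<ge> N \<Longrightarrow> 1 \<le> \<delta> / 2 * real n"
    "\<And>n m. n \<ge> N \<Longrightarrow> m \<le> n \<Longrightarrow> (1 - \<delta>) * real n \<le> real m \<Longrightarrow> extr m \<le> (1 + \<eta>') * extr n"
    "\<And>n m. n \<ge> N \<Longrightarrow> (1 - \<delta>) * real n \<le> real m \<Longrightarrow> real m \<le> (1 - \<delta> / 2) * real n \<Longrightarrow>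
        extr m \<le> (1 - \<gamma>) * extr n"
    using eventually_conj[OF eventually_conj[OF drop near[rule_format, OF \<eta>'(1)]] eventually_le_mult_nat[of "\<delta> / 2" 1]] \<delta>
    unfolding eventually_sequentially by auto
  have "N \<le> m \<Longrightarrow> m \<le> n \<Longrightarrow> extr m \<le> (1 + \<eta>') * extr n" for m n
  proof (induction n rule: less_induct)
    case (less n)
    show ?case
    proof (cases "(1 - \<delta>) * real n \<le> real m")
      case True
      then show ?thesis using N(2) less by auto
    next
      case False
      \<comment> \<open>The least integer of the drop window; rounding stays inside it because
        \<open>\<delta> / 2 * real n\<close> is at least 1.\<close>
      define l where "l = nat \<lceil>(1 - \<delta>) * real n\<rceil>"
      have "0 \<le> (1 - \<delta>) * real n" using \<delta> by simp
      then have l: "(1 - \<delta>) * real n \<le> real l" "real l \<le> (1 - \<delta>) * real n + 1"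
        unfolding l_def by linarith+
      moreover have "1 \<le> \<delta> / 2 * real n" using N(1) less by auto
      ultimately have l2: "real l \<le> (1 - \<delta> / 2) * real n" by (simp add: algebra_simps)
      have "real l < real n" "m \<le> l"
        using l2 \<open>1 \<le> \<delta> / 2 * real n\<close> False l(1) by (auto simp: algebra_simps)
      then have "extr m \<le> (1 + \<eta>') * extr l" using less by auto
      also have "\<dots> \<le> (1 + \<eta>') * ((1 - \<gamma>) * extr n)"
        using N(3)[of n l] l l2 less \<eta>' by (intro mult_left_mono) auto
      also have "\<dots> \<le> (1 + \<eta>') * (1 * extr n)"
        using \<eta>' \<delta> by (intro mult_left_mono mult_right_mono extr_nonneg) auto
      finally show ?thesis by simp
    qed
  qed
  moreover have "(1 + \<eta>') * extr n \<le> (1 + \<eta>) * extr n" for n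
    using \<eta>' by (intro mult_right_mono extr_nonneg) auto
  ultimately show ?thesis by (meson order_trans)
qed

text \<open>Otherwise almost monotonicity bounds a tail of \<open>extr\<close>. Take
  \<open>m\<close> in it with a value above \<open>1 - \<gamma>\<close> times the supremum
  \<open>s\<close>; an \<open>n\<close> whose drop window contains \<open>m\<close> would then have
  a value above \<open>s\<close>.\<close>

lemma extr_at_top: "filterlim extr at_top sequentially"
proof (rule ccontr)
  assume "\<not> filterlim extr at_top sequentially"
  then obtain Z where Z: "\<not> (\<forall>\<^sub>F n in sequentially. Z \<le> extr n)"
    unfolding filterlim_at_top by blast
  obtain N1 where N1: "\<And>n m. N1 \<le> m \<Longrightarrow> m \<le> n \<Longrightarrow> extr m \<le> 2 * extr n"
    using extr_almost_mono_above[of 1] by auto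
  have bound: "extr m \<le> 2 * Z" if "N1 \<le> m" for m
  proof -
    obtain n where "n \<ge> m" "extr n < Z"
      using Z unfolding eventually_sequentially by (metis not_le)
    then show ?thesis using N1[OF that] by force
  qed
  obtain \<delta> \<gamma> where \<delta>: "0 < \<delta>" "\<delta> < 1" "0 < \<gamma>" "\<gamma> < 1" and
    drop: "\<forall>\<^sub>F n in sequentially. \<forall>m. (1 - \<delta>) * real n \<le> real m \<longrightarrow> real m \<le> (1 - \<delta> / 2) * real n \<longrightarrow>
        extr m \<le> (1 - \<gamma>) * extr n"
    using extr_drop_window by blast
  obtain N where N: "\<And>n. n \<ge> N \<Longrightarrow> 1 \<le> \<delta> / 2 * real n" "\<And>n. n \<ge> N \<Longrightarrow> 0 < extr n" "N \<ge> N1"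
    "\<And>n m. n \<ge> N \<Longrightarrow> (1 - \<delta>) * real n \<le> real m \<Longrightarrow> real m \<le> (1 - \<delta> / 2) * real n \<Longrightarrow>
        extr m \<le> (1 - \<gamma>) * extr n"
    using eventually_conj[OF eventually_conj[OF drop extr_pos]
        eventually_conj[OF eventually_le_mult_nat[of "\<delta> / 2" 1] eventually_ge_at_top[of N1]]] \<delta>
    unfolding eventually_sequentially by auto
  define s where "s = (SUP n\<in>{N..}. extr n)"
  have bdd: "bdd_above (extr ` {N..})"
    using bound N(3) by (intro bdd_aboveI[of _ "2 * Z"]) auto
  have le_s: "extr n \<le> s" if "N \<le> n" for n
    unfolding s_def using that by (intro cSUP_upper bdd) auto
  have "0 < s" using N(2)[of N] le_s[of N] by simp
  then have "(1 - \<gamma>) * s < s" using \<delta> by simp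
  then obtain m where m: "N \<le> m" "(1 - \<gamma>) * s < extr m"
    using less_cSUP_iff[OF _ bdd, of "(1 - \<gamma>) * s"] unfolding s_def[symmetric] by auto
  \<comment> \<open>The least \<open>n\<close> for which \<open>m\<close> is below the upper end of
    the drop window; the rounding is absorbed at the lower end by
    \<open>1 \<le> \<delta> / 2 * real n\<close>.\<close>
  define n where "n = nat \<lceil>real m / (1 - \<delta> / 2)\<rceil>"
  have "0 \<le> real m / (1 - \<delta> / 2)" using \<delta> by simp
  then have "real m / (1 - \<delta> / 2) \<le> real n" "real n \<le> real m / (1 - \<delta> / 2) + 1"
    unfolding n_def by linarith+
  then have n: "real m \<le> (1 - \<delta> / 2) * real n" "(1 - \<delta> / 2) * real n \<le> real m + (1 - \<delta> / 2)"
    using \<delta> by (simp_all add: field_simps)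
  have "(1 - \<delta> / 2) * real n \<le> 1 * real n" using \<delta> by (intro mult_right_mono) auto
  then have mn: "m \<le> n" using n(1) by simp
  have "1 \<le> \<delta> / 2 * real n" using N(1) mn m by auto
  then have "(1 - \<delta>) * real n \<le> real m" using n(2) \<delta> by (simp add: algebra_simps)
  then have "extr m \<le> (1 - \<gamma>) * extr n" using N(4) n(1) mn m by auto
  also have "\<dots> \<le> (1 - \<gamma>) * s" using \<delta> le_s mn m by (intro mult_left_mono) auto
  finally show False using m by simp
qed

text \<open>The finitely many small \<open>m\<close> left open by
  \<open>extr_almost_mono_above\<close> are covered by divergence.\<close>

lemma extr_almost_mono:
  assumes "0 < \<eta>"
  shows "\<forall>\<^sub>F n in sequentially. \<forall>m\<le>n. extr m \<le> (1 + \<eta>) * extr n"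
proof -
  obtain N where N: "\<And>n m. N \<le> m \<Longrightarrow> m \<le> n \<Longrightarrow> extr m \<le> (1 + \<eta>) * extr n"
    using extr_almost_mono_above[OF assms] by auto
  have "\<forall>\<^sub>F n in sequentially. Max (extr ` {..N}) \<le> extr n"
    using extr_at_top unfolding filterlim_at_top by blast
  then show ?thesis
  proof eventually_elim
    case (elim n)
    show ?case
    proof (intro allI impI)
      fix m assume m: "m \<le> n"
      show "extr m \<le> (1 + \<eta>) * extr n"
      proof (cases "m \<le> N")
        case True
        then have "extr m \<le> Max (extr ` {..N})" by (intro Max_ge) auto
        also have "\<dots> \<le> 1 * extr n" using elim by simp
        also have "\<dots> \<le> (1 + \<eta>) * extr n" using assms by (intro mult_right_mono extr_nonneg) auto
        finally show ?thesis .
      qed (use N m in auto)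
    qed
  qed
qed

text \<open>Smoothness gives the drop only near \<open>n\<close>. It is taken at an \<open>l\<close>
  just above \<open>(1 - d) * n\<close> and carried down to all smaller \<open>m\<close> by almost
  monotonicity, at the price of reducing \<open>2 * \<gamma>\<close> to
  \<open>\<gamma>\<close>.\<close>

lemma extr_drop:
  assumes "0 < \<delta>"
  obtains \<gamma> where "0 < \<gamma>" "\<gamma> < 1"
    "\<forall>\<^sub>F n in sequentially. \<forall>m. real m \<le> (1 - \<delta>) * real n \<longrightarrow> extr m \<le> (1 - \<gamma>) * extr n"
proof -
  have "k / 2 < k" using k_pos by simp
  then obtain \<delta>0 where \<delta>0: "0 < \<delta>0" "\<delta>0 < 1" and
    slope: "\<And>\<eta>. 0 < \<eta> \<Longrightarrow> \<forall>\<^sub>F n in sequentially. \<forall>m\<le>n. (1 - \<delta>0) * real n \<le> real m \<longrightarrow>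
        extr m \<le> (1 - (1 - real m / real n) * (k / 2) + \<eta>) * extr n"
    using smooth_slope by blast
  define d where "d = min \<delta> \<delta>0"
  have d: "0 < d" "d < 1" "d \<le> \<delta>" "d \<le> \<delta>0" using \<delta>0 assms by (auto simp: d_def)
  define \<gamma> where "\<gamma> = min (d * k / 16) (1 / 4)"
  have \<gamma>: "0 < \<gamma>" "\<gamma> < 1" "\<gamma> \<le> d * k / 16" "\<gamma> \<le> 1/4" using d k_pos by (auto simp: \<gamma>_def)
  have dk: "0 < d * k / 8" and d2: "0 < d / 2" and d1: "0 < 1 - d" using d k_pos by auto
  obtain N where N: "\<And>n m. N \<le> n \<Longrightarrow> m \<le> n \<Longrightarrow> extr m \<le> (1 + \<gamma>) * extr n"
    using extr_almost_mono[OF \<gamma>(1)] unfolding eventually_sequentially by (meson order_trans)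
  have "\<forall>\<^sub>F n in sequentially. \<forall>m. real m \<le> (1 - \<delta>) * real n \<longrightarrow> extr m \<le> (1 - \<gamma>) * extr n"
    using slope[OF dk] eventually_le_mult_nat[OF d2, of 1]
      eventually_le_mult_nat[OF d1, of N] eventually_gt_at_top[of 0]
  proof eventually_elim
    case (elim n)
    show ?case
    proof (intro allI impI)
      fix m assume m: "real m \<le> (1 - \<delta>) * real n"
      define l where "l = nat \<lceil>(1 - d) * real n\<rceil>"
      have "0 \<le> (1 - d) * real n" using d by simp
      then have l: "(1 - d) * real n \<le> real l" "real l \<le> (1 - d) * real n + 1"
        unfolding l_def by linarith+
      then have l2: "real l \<le> (1 - d / 2) * real n" using elim by (simp add: algebra_simps)
      also have "\<dots> \<le> 1 * real n" using d by (intro mult_right_mono) auto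
      finally have ln: "l \<le> n" by simp
      have "(1 - \<delta>) * real n \<le> (1 - d) * real n" using d by (intro mult_right_mono) auto
      then have ml: "m \<le> l" using m l by linarith
      have "(1 - \<delta>0) * real n \<le> (1 - d) * real n" using d by (intro mult_right_mono) auto
      then have "extr l \<le> (1 - (1 - real l / real n) * (k / 2) + d * k / 8) * extr n"
        using elim(1) ln l(1) by (meson order_trans)
      also have "\<dots> \<le> (1 - 2 * \<gamma>) * extr n"
      proof (intro mult_right_mono extr_nonneg)
        have "d / 2 \<le> 1 - real l / real n" using l2 elim by (simp add: field_simps)
        then have "d / 2 * (k / 2) \<le> (1 - real l / real n) * (k / 2)"
          using k_pos by (intro mult_right_mono) auto
        then show "1 - (1 - real l / real n) * (k / 2) + d * k / 8 \<le> 1 - 2 * \<gamma>"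
          using \<gamma>(3) by linarith
      qed
      finally have l3: "extr l \<le> (1 - 2 * \<gamma>) * extr n" .
      have "extr m \<le> (1 + \<gamma>) * extr l" using N[OF _ ml] l elim by auto
      also have "\<dots> \<le> (1 + \<gamma>) * ((1 - 2 * \<gamma>) * extr n)"
        using l3 \<gamma> by (intro mult_left_mono) auto
      also have "\<dots> = ((1 + \<gamma>) * (1 - 2 * \<gamma>)) * extr n" by simp
      also have "\<dots> \<le> (1 - \<gamma>) * extr n"
        by (intro mult_right_mono extr_nonneg) (simp add: algebra_simps)
      finally show "extr m \<le> (1 - \<gamma>) * extr n" .
    qed
  qed
  show thesis by (rule that[OF \<gamma>(1,2)]) fact
qed

end

section \<open>Vertices of large degree\<close>

context pos_hgraph_parameter
begin

definition high :: "real \<Rightarrow> nat \<Rightarrow> 'a hgraph \<Rightarrow> 'a set" where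
  "high \<epsilon> n H = {v \<in> verts H. (1 - \<epsilon>) * exdeg r k \<Gamma> n \<le> deg \<Gamma> H v}"

lemma high_subset: "high \<epsilon> n H \<subseteq> verts H"
  by (auto simp: high_def)

lemma exdeg_nonneg: "0 \<le> exdeg r k \<Gamma> n"
  using k_pos extr_nonneg by (simp add: exdeg_def)

text \<open>Deleting many low-degree vertices lowers \<open>\<Gamma>\<close> at a rate of at most
  \<open>(1 - \<epsilon>) * k\<close>, whereas the extremal value falls at a rate of at least
  \<open>\<kappa> = (1 - \<epsilon> / 2) * k\<close>. A near-extremal graph would thereby end up
  above the extremal value of its new order.\<close>

lemma card_high_ge:
  assumes "0 < \<epsilon>" "0 < \<delta>"
  obtains \<eta> where "0 < \<eta>"
    "\<forall>\<^sub>F n in sequentially. \<forall>H\<in>rgraphs_on r n. (1 - \<eta>) * extr n \<le> \<Gamma> H \<longrightarrow>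
        (1 - \<delta>) * real n \<le> real (card (high \<epsilon> n H))"
proof -
  define \<kappa> where "\<kappa> = (1 - \<epsilon> / 2) * k"
  have "\<kappa> < k" using k_pos assms by (simp add: \<kappa>_def algebra_simps)
  then obtain \<delta>0 where \<delta>0: "0 < \<delta>0" "\<delta>0 < 1" and
    slope: "\<And>\<eta>. 0 < \<eta> \<Longrightarrow> \<forall>\<^sub>F n in sequentially. \<forall>m\<le>n. (1 - \<delta>0) * real n \<le> real m \<longrightarrow>
        extr m \<le> (1 - (1 - real m / real n) * \<kappa> + \<eta>) * extr n"
    using smooth_slope by blast
  define d where "d = min \<delta> \<delta>0"
  have d: "0 < d" "d < 1" "d \<le> \<delta>" "d \<le> \<delta>0" using \<delta>0 assms by (auto simp: d_def)
  define \<eta> where "\<eta> = min (d * k * \<epsilon> / 16) (1 / 2)"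
  have \<eta>: "0 < \<eta>" "\<eta> \<le> 1/2" "\<eta> \<le> d * k * \<epsilon> / 16" using d k_pos assms by (auto simp: \<eta>_def)
  have d2: "0 < d / 2" using d by simp
  have "\<forall>\<^sub>F n in sequentially. \<forall>H\<in>rgraphs_on r n. (1 - \<eta>) * extr n \<le> \<Gamma> H \<longrightarrow>
        (1 - \<delta>) * real n \<le> real (card (high \<epsilon> n H))"
    using slope[OF \<eta>(1)] extr_pos eventually_le_mult_nat[OF d2, of 1] eventually_gt_at_top[of 0]
  proof eventually_elim
    case (elim n)
    show ?case
    proof (intro ballI impI)
      fix H assume H: "H \<in> rgraphs_on r n" "(1 - \<eta>) * extr n \<le> \<Gamma> H"
      have Hr: "H \<in> rgraphs r" "card (verts H) = n" "finite (verts H)"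
        using H by (auto simp: rgraphs_on_def rgraphs_def)
      have "0 < (1 - \<eta>) * extr n" using \<eta> elim by simp
      then have pos: "0 < \<Gamma> H" using H by linarith
      define Z where "Z = verts H - high \<epsilon> n H"
      have "card Z = n - card (high \<epsilon> n H)" "card (high \<epsilon> n H) \<le> n"
        using Hr high_subset[of \<epsilon> n H] by (auto simp: Z_def card_Diff_subset finite_subset intro: card_mono)
      then have cardZ: "real (card Z) = real n - real (card (high \<epsilon> n H))" by simp
      show "(1 - \<delta>) * real n \<le> real (card (high \<epsilon> n H))"
      proof (rule ccontr)
        assume "\<not> ?thesis"
        then have Zgt: "\<delta> * real n < real (card Z)" using cardZ by (simp add: algebra_simps)
        \<comment> \<open>Only about \<open>d * n\<close> of the low-degree vertices are deleted,
          however many there are, so that the new order stays in the smoothness window.\<close>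
        define t where "t = nat \<lfloor>d * real n\<rfloor>"
        have "0 \<le> d * real n" using d by simp
        then have t: "real t \<le> d * real n" "d * real n - 1 \<le> real t" unfolding t_def by linarith+
        have "d * real n \<le> \<delta> * real n" using d by (intro mult_right_mono) auto
        then have "t \<le> card Z" using t Zgt by linarith
        then obtain X where X: "X \<subseteq> Z" "card X = t" by (meson obtain_subset_with_card_n)
        then have XV: "X \<subseteq> verts H" by (auto simp: Z_def)
        let ?I = "induced H (verts H - X)"
        have cardI: "real (card (verts H - X)) = real n - real t"
          using X XV Hr card_mono[OF Hr(3) XV] by (subst card_Diff_subset) (auto intro: finite_subset)
        define x where "x = real t / real n"
        have x: "d / 2 \<le> x" "x \<le> d" using t elim by (auto simp: x_def field_simps)
        have "x = 1 - real (card (verts H - X)) / real n"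
          using cardI elim by (simp add: x_def field_simps)
        moreover have "(1 - \<delta>0) * real n \<le> real (card (verts H - X))"
        proof -
          have "d * real n \<le> \<delta>0 * real n" using d by (intro mult_right_mono) auto
          then show ?thesis using cardI t by (simp add: algebra_simps)
        qed
        moreover have "card (verts H - X) \<le> n" using cardI by linarith
        ultimately have up: "extr (card (verts H - X)) \<le> (1 - x * \<kappa> + \<eta>) * extr n"
          using elim(1) by metis
        have "(\<Sum>v\<in>X. deg \<Gamma> H v) \<le> real (card X) * ((1 - \<epsilon>) * exdeg r k \<Gamma> n)"
          using X by (intro sum_bounded_above) (auto simp: Z_def high_def)
        also have "\<dots> = x * (1 - \<epsilon>) * k * extr n"
          using X by (simp add: x_def exdeg_def)
        finally have "\<Gamma> H - x * (1 - \<epsilon>) * k * extr n \<le> \<Gamma> ?I"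
          using \<Gamma>_diff_ge[OF Hr(1) pos XV] by linarith
        also have "\<dots> \<le> extr (card (verts H - X))"
          using Hr by (intro le_extr induced_in_rgraphs_on) auto
        finally have "(1 - \<eta>) * extr n - x * (1 - \<epsilon>) * k * extr n \<le> (1 - x * \<kappa> + \<eta>) * extr n"
          using up H by linarith
        then have "(1 - \<eta> - x * (1 - \<epsilon>) * k) * extr n \<le> (1 - x * \<kappa> + \<eta>) * extr n"
          by (simp add: algebra_simps)
        then have "1 - \<eta> - x * (1 - \<epsilon>) * k \<le> 1 - x * \<kappa> + \<eta>"
          using elim by (meson mult_le_cancel_right_pos)
        then have "x * (k * \<epsilon>) \<le> 4 * \<eta>" by (simp add: \<kappa>_def algebra_simps)
        moreover have "d / 2 * (k * \<epsilon>) \<le> x * (k * \<epsilon>)"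
          using x k_pos assms by (intro mult_right_mono) auto
        moreover have "0 < d * (k * \<epsilon>)" using d k_pos assms by simp
        ultimately show False using \<eta>(3) by (simp add: mult_ac)
      qed
    qed
  qed
  then show thesis by (rule that[OF \<eta>(1)])
qed

text \<open>Two things change when passing to \<open>W\<close>: the degree drops by the Lipschitz
  term, and the threshold \<open>exdeg\<close> moves to the order \<open>card W\<close>, growing by
  a factor of at most \<open>(1 + \<eta>) / (1 - \<delta>)\<close>. Doubling
  \<open>\<epsilon>\<close> pays for both.\<close>

lemma degree_induced_ge:
  assumes "0 < \<epsilon>" "\<epsilon> < 1 / 2"
  obtains \<delta> where "0 < \<delta>" "\<delta> < 1"
    "\<forall>\<^sub>F n in sequentially. \<forall>H\<in>rgraphs_on r n. 0 < \<Gamma> H \<longrightarrow>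
       (\<forall>W\<subseteq>verts H. (1 - \<delta>) * real n \<le> real (card W) \<longrightarrow>
         (\<forall>v\<in>W. (1 - \<epsilon>) * exdeg r k \<Gamma> n \<le> deg \<Gamma> H v \<longrightarrow>
           (1 - 2 * \<epsilon>) * exdeg r k \<Gamma> (card W) \<le> deg \<Gamma> (induced H W) v))"
proof -
  obtain C f where C: "0 < C" "f \<in> o(exdeg r k \<Gamma>)"
    "\<And>n H W v. H \<in> rgraphs_on r n \<Longrightarrow> 0 < \<Gamma> H \<Longrightarrow> W \<subseteq> verts H \<Longrightarrow> v \<in> W \<Longrightarrow>
       deg \<Gamma> H v - C * (real n - real (card W)) / real n * exdeg r k \<Gamma> n - f n \<le> deg \<Gamma> (induced H W) v"
    using lipschitz unfolding locally_lipschitz_def by metis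
  \<comment> \<open>Chosen so that \<open>C * \<delta> + \<delta> \<le> \<epsilon> / 2\<close>;
    together with two errors of \<open>\<eta> = \<epsilon> / 4\<close> this uses exactly the
    available \<open>\<epsilon>\<close>.\<close>
  define \<delta> where "\<delta> = min (\<epsilon> / (2 * (C + 1))) (1 / 2)"
  have \<delta>: "0 < \<delta>" "\<delta> \<le> 1/2" using C assms by (auto simp: \<delta>_def)
  have "\<delta> \<le> \<epsilon> / (2 * (C + 1))" by (simp add: \<delta>_def)
  then have "\<delta> * (2 * (C + 1)) \<le> \<epsilon>" using C(1) by (subst (asm) pos_le_divide_eq) auto
  then have C\<delta>: "C * \<delta> + \<delta> \<le> \<epsilon> / 2" by (simp add: algebra_simps)
  define \<eta> where "\<eta> = \<epsilon> / 4"
  have \<eta>: "0 < \<eta>" using assms by (simp add: \<eta>_def)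
  have key: "(1 - 2 * \<epsilon>) * (1 + \<eta>) \<le> (1 - \<epsilon> - C * \<delta> - \<eta>) * (1 - \<delta>)"
  proof -
    have "(1 - 2 * \<epsilon>) * (1 + \<eta>) \<le> 1 - 2 * \<epsilon> + \<eta>" using assms \<eta> by (simp add: algebra_simps)
    also have "\<dots> \<le> 1 - \<epsilon> - C * \<delta> - \<eta> - \<delta>" using C\<delta> by (simp add: \<eta>_def)
    also have "\<dots> \<le> (1 - \<epsilon> - C * \<delta> - \<eta>) * (1 - \<delta>)"
    proof -
      have "0 \<le> \<delta> * (\<epsilon> + C * \<delta> + \<eta>)" using \<delta> C assms \<eta> by simp
      then show ?thesis by (simp add: algebra_simps)
    qed
    finally show ?thesis .
  qed
  have "\<forall>\<^sub>F n in sequentially. \<forall>H\<in>rgraphs_on r n. 0 < \<Gamma> H \<longrightarrow>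
       (\<forall>W\<subseteq>verts H. (1 - \<delta>) * real n \<le> real (card W) \<longrightarrow>
         (\<forall>v\<in>W. (1 - \<epsilon>) * exdeg r k \<Gamma> n \<le> deg \<Gamma> H v \<longrightarrow>
           (1 - 2 * \<epsilon>) * exdeg r k \<Gamma> (card W) \<le> deg \<Gamma> (induced H W) v))"
    using smallo_eventually_le[OF C(2) \<eta> exdeg_nonneg] extr_almost_mono[OF \<eta>] eventually_gt_at_top[of 0]
  proof eventually_elim
    case (elim n)
    show ?case
    proof (intro ballI allI impI)
      fix H W v assume H: "H \<in> rgraphs_on r n" "0 < \<Gamma> H" "W \<subseteq> verts H"
        "(1 - \<delta>) * real n \<le> real (card W)" "v \<in> W" "(1 - \<epsilon>) * exdeg r k \<Gamma> n \<le> deg \<Gamma> H v"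
      let ?m = "card W" let ?e = "exdeg r k \<Gamma> n"
      have mn: "?m \<le> n" using H by (auto simp: rgraphs_on_def rgraphs_def intro: card_mono)
      have "0 < (1 - \<delta>) * real n" using \<delta> elim by simp
      then have m0: "0 < real ?m" using H by linarith
      have "real n - real ?m \<le> \<delta> * real n" using H(4) by (simp add: algebra_simps)
      then have "C * (real n - real ?m) \<le> C * (\<delta> * real n)" using C(1) by (intro mult_left_mono) auto
      then have "C * (real n - real ?m) / real n \<le> C * \<delta>" using elim(3) by (simp add: pos_divide_le_eq)
      then have "C * (real n - real ?m) / real n * ?e \<le> C * \<delta> * ?e"
        by (intro mult_right_mono exdeg_nonneg)
      then have lower: "(1 - \<epsilon> - C * \<delta> - \<eta>) * ?e \<le> deg \<Gamma> (induced H W) v"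
        using C(3)[OF H(1,2,3,5)] H(6) elim(1) by (simp add: algebra_simps)
      have "exdeg r k \<Gamma> ?m \<le> k * ((1 + \<eta>) * extr n) / real ?m"
        unfolding exdeg_def using elim mn k_pos by (intro divide_right_mono mult_left_mono) auto
      also have "\<dots> \<le> k * ((1 + \<eta>) * extr n) / ((1 - \<delta>) * real n)"
        using \<open>0 < (1 - \<delta>) * real n\<close> H m0 k_pos \<eta> extr_nonneg by (intro divide_left_mono) auto
      also have "\<dots> = (1 + \<eta>) / (1 - \<delta>) * ?e" using \<delta> by (simp add: exdeg_def)
      finally have "(1 - 2 * \<epsilon>) * exdeg r k \<Gamma> ?m \<le> (1 - 2 * \<epsilon>) * ((1 + \<eta>) / (1 - \<delta>) * ?e)"
        using assms by (intro mult_left_mono) auto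
      also have "\<dots> = ((1 - 2 * \<epsilon>) * (1 + \<eta>)) / (1 - \<delta>) * ?e" by simp
      also have "\<dots> \<le> (1 - \<epsilon> - C * \<delta> - \<eta>) * ?e"
        using key \<delta> by (intro mult_right_mono exdeg_nonneg) (simp add: pos_divide_le_eq)
      finally show "(1 - 2 * \<epsilon>) * exdeg r k \<Gamma> ?m \<le> deg \<Gamma> (induced H W) v" using lower by linarith
    qed
  qed
  then show thesis using that[of \<delta>] \<delta> by auto
qed

text \<open>All vertices of \<open>S\<close> have large degree in \<open>H\<close>, hence, by
  \<open>degree_induced_ge\<close>, in every induced subgraph between \<open>W\<close> and
  \<open>S\<close>. So vertex extension applies at each step, in whatever order the vertices of
  \<open>S\<close> are added.\<close>

lemma extend_induced:
  assumes "vertex_extendable r k \<Gamma> \<HH>"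
  obtains \<epsilon> \<delta> where "0 < \<epsilon>" "0 < \<delta>" "\<delta> < 1"
    "\<forall>\<^sub>F n in sequentially. \<forall>H\<in>rgraphs_on r n. 0 < \<Gamma> H \<longrightarrow>
       (\<forall>W S. W \<subseteq> S \<longrightarrow> S \<subseteq> high \<epsilon> n H \<longrightarrow> (1 - \<delta>) * real n \<le> real (card W) \<longrightarrow>
         induced H W \<in> \<HH> \<longrightarrow> induced H S \<in> \<HH>)"
proof -
  obtain \<epsilon>0 N0 where ve: "0 < \<epsilon>0"
    "\<And>n H v. N0 \<le> n \<Longrightarrow> H \<in> rgraphs_on r n \<Longrightarrow> (1 - \<epsilon>0) * exdeg r k \<Gamma> n \<le> min_deg \<Gamma> H \<Longrightarrow>
      v \<in> verts H \<Longrightarrow> del_vertex H v \<in> \<HH> \<Longrightarrow> H \<in> \<HH>"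
    using assms unfolding vertex_extendable_def by metis
  define \<epsilon> where "\<epsilon> = min (\<epsilon>0 / 2) (1 / 4)"
  have \<epsilon>: "0 < \<epsilon>" "\<epsilon> < 1/2" "2 * \<epsilon> \<le> \<epsilon>0" using ve by (auto simp: \<epsilon>_def)
  obtain \<delta> where \<delta>: "0 < \<delta>" "\<delta> < 1" and
    deg: "\<forall>\<^sub>F n in sequentially. \<forall>H\<in>rgraphs_on r n. 0 < \<Gamma> H \<longrightarrow>
       (\<forall>W\<subseteq>verts H. (1 - \<delta>) * real n \<le> real (card W) \<longrightarrow>
         (\<forall>v\<in>W. (1 - \<epsilon>) * exdeg r k \<Gamma> n \<le> deg \<Gamma> H v \<longrightarrow>
           (1 - 2 * \<epsilon>) * exdeg r k \<Gamma> (card W) \<le> deg \<Gamma> (induced H W) v))"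
    using degree_induced_ge[OF \<epsilon>(1,2)] by blast
  have \<delta>': "0 < 1 - \<delta>" using \<delta> by simp
  have "\<forall>\<^sub>F n in sequentially. \<forall>H\<in>rgraphs_on r n. 0 < \<Gamma> H \<longrightarrow>
       (\<forall>W S. W \<subseteq> S \<longrightarrow> S \<subseteq> high \<epsilon> n H \<longrightarrow> (1 - \<delta>) * real n \<le> real (card W) \<longrightarrow>
         induced H W \<in> \<HH> \<longrightarrow> induced H S \<in> \<HH>)"
    using deg eventually_le_mult_nat[OF \<delta>', of N0]
  proof eventually_elim
    case (elim n)
    show ?case
    proof (intro ballI allI impI)
      fix H W S assume H: "H \<in> rgraphs_on r n" "0 < \<Gamma> H" "W \<subseteq> S" "S \<subseteq> high \<epsilon> n H"
        "(1 - \<delta>) * real n \<le> real (card W)" "induced H W \<in> \<HH>"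
      have SV: "S \<subseteq> verts H" using H(4) high_subset by blast
      have Hr: "H \<in> rgraphs r" "finite (verts H)" using H by (auto simp: rgraphs_on_def rgraphs_def)
      have finS: "finite S" by (rule finite_subset[OF SV Hr(2)])
      have "T \<subseteq> S \<Longrightarrow> induced H (W \<union> T) \<in> \<HH>" if "finite T" for T
        using that
      proof (induction T rule: finite_induct)
        case empty
        then show ?case using H by simp
      next
        case (insert x T)
        let ?U = "W \<union> insert x T" let ?G = "induced H ?U"
        have U: "?U \<subseteq> S" "?U \<subseteq> verts H" using insert H SV by auto
        have finU: "finite ?U" by (rule finite_subset[OF U(1) finS])
        have IH: "induced H (W \<union> T) \<in> \<HH>" using insert by auto
        show ?case
        proof (cases "x \<in> W")
          case True
          then show ?thesis using IH by (simp add: insert_absorb)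
        next
          case False
          have cW: "card W \<le> card ?U" using finU by (intro card_mono) auto
          then have cU: "(1 - \<delta>) * real n \<le> real (card ?U)" using H by linarith
          show ?thesis
          proof (rule ve(2)[of "card ?U" _ x])
            show "N0 \<le> card ?U" using elim cU by linarith
            show "?G \<in> rgraphs_on r (card ?U)" using Hr U by (intro induced_in_rgraphs_on)
            show "x \<in> verts ?G" by simp
            have "?U - {x} = W \<union> T" using False insert by auto
            then show "del_vertex ?G x \<in> \<HH>" using IH by (simp add: del_vertex_induced)
            have "(1 - \<epsilon>0) * exdeg r k \<Gamma> (card ?U) \<le> deg \<Gamma> ?G v" if "v \<in> ?U" for v
            proof -
              have "(1 - \<epsilon>) * exdeg r k \<Gamma> n \<le> deg \<Gamma> H v" using that U H(4) by (auto simp: high_def)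
              then have "(1 - 2 * \<epsilon>) * exdeg r k \<Gamma> (card ?U) \<le> deg \<Gamma> ?G v"
                using elim(1) H(1,2) U(2) cU that by blast
              moreover have "(1 - \<epsilon>0) * exdeg r k \<Gamma> (card ?U) \<le> (1 - 2 * \<epsilon>) * exdeg r k \<Gamma> (card ?U)"
                using \<epsilon> by (intro mult_right_mono exdeg_nonneg) auto
              ultimately show ?thesis by linarith
            qed
            then show "(1 - \<epsilon>0) * exdeg r k \<Gamma> (card ?U) \<le> min_deg \<Gamma> ?G"
              unfolding min_deg_def verts_induced using finU
              by (subst Min_ge_iff) blast+
          qed
        qed
      qed
      from this[OF finS] show "induced H S \<in> \<HH>" using H(3) by (simp add: Un_absorb1)
    qed
  qed
  then show thesis by (rule that[OF \<epsilon>(1) \<delta>])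
qed

text \<open>
  Symmetrizing \<open>H\<close> into \<open>H'\<close> changes only edges at one vertex \<open>u\<close>. If the high-degree part of \<open>H'\<close>
  is in the family, then so is almost all of the high-degree part of \<open>H\<close>, and the few missing
  vertices can be put back one at a time by vertex extension. A near-extremal counterexample that
  is maximal for \<open>\<Gamma>\<close>, and then for the number of equivalent pairs, therefore cannot exist.
\<close>

lemma near_extremal_core:
  assumes her: "hereditary r \<HH>" and inc: "symmetrization_increasing r \<Gamma>"
    and sst: "symmetrized_stable r \<Gamma> \<HH>" and ve: "vertex_extendable r k \<Gamma> \<HH>" and \<delta>: "0 < \<delta>"
  obtains \<eta> where "0 < \<eta>"
    "\<forall>\<^sub>F n in sequentially. \<forall>H\<in>rgraphs_on r n. (1 - \<eta>) * extr n \<le> \<Gamma> H \<longrightarrow>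
       (\<exists>W\<subseteq>verts H. (1 - \<delta>) * real n \<le> real (card W) \<and> induced H W \<in> \<HH>)"
proof -
  obtain \<epsilon> \<delta>0 where \<epsilon>: "0 < \<epsilon>" "0 < \<delta>0" "\<delta>0 < 1" and
    ext: "\<forall>\<^sub>F n in sequentially. \<forall>H\<in>rgraphs_on r n. 0 < \<Gamma> H \<longrightarrow>
       (\<forall>W S. W \<subseteq> S \<longrightarrow> S \<subseteq> high \<epsilon> n H \<longrightarrow> (1 - \<delta>0) * real n \<le> real (card W) \<longrightarrow>
         induced H W \<in> \<HH> \<longrightarrow> induced H S \<in> \<HH>)"
    using extend_induced[OF ve] by blast
  \<comment> \<open>Intersecting two high-degree sets loses \<open>2 * d * n\<close> vertices and
    removing the altered vertex loses one more, at most \<open>d * n\<close>.\<close>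
  define d where "d = min \<delta> (\<delta>0 / 4)"
  have d: "0 < d" "d \<le> \<delta>" "4 * d \<le> \<delta>0" using \<delta> \<epsilon> by (auto simp: d_def)
  obtain \<eta>0 where \<eta>0: "0 < \<eta>0" and
    core: "\<forall>\<^sub>F n in sequentially. \<forall>H\<in>rgraphs_on r n. (1 - \<eta>0) * extr n \<le> \<Gamma> H \<longrightarrow>
        (1 - d) * real n \<le> real (card (high \<epsilon> n H))"
    using card_high_ge[OF \<epsilon>(1) d(1)] by blast
  define \<eta> where "\<eta> = min \<eta>0 (1 / 2)"
  have \<eta>: "0 < \<eta>" "\<eta> \<le> \<eta>0" "\<eta> \<le> 1/2" using \<eta>0 by (auto simp: \<eta>_def)
  have "\<forall>\<^sub>F n in sequentially. \<forall>H\<in>rgraphs_on r n. (1 - \<eta>) * extr n \<le> \<Gamma> H \<longrightarrow>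
       (\<exists>W\<subseteq>verts H. (1 - \<delta>) * real n \<le> real (card W) \<and> induced H W \<in> \<HH>)"
    using ext core extr_pos eventually_le_mult_nat[OF d(1), of 1]
  proof eventually_elim
    case (elim n)
    have large: "(1 - d) * real n \<le> real (card (high \<epsilon> n H))" "0 < \<Gamma> H"
      if "H \<in> rgraphs_on r n" "(1 - \<eta>) * extr n \<le> \<Gamma> H" for H
    proof -
      have "(1 - \<eta>0) * extr n \<le> (1 - \<eta>) * extr n"
        using \<eta> by (intro mult_right_mono extr_nonneg) auto
      then show "(1 - d) * real n \<le> real (card (high \<epsilon> n H))" using elim(2) that by force
      have "0 < (1 - \<eta>) * extr n" using \<eta> elim(3) by simp
      then show "0 < \<Gamma> H" using that by linarith
    qed
    have in_family: "induced H (high \<epsilon> n H) \<in> \<HH>"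
      if H: "H \<in> rgraphs_on r n" "(1 - \<eta>) * extr n \<le> \<Gamma> H" for H
    proof (rule ccontr)
      assume notin: "induced H (high \<epsilon> n H) \<notin> \<HH>"
      define V where "V = verts H"
      define B where "B = {G \<in> rgraphs r. verts G = V \<and> (1 - \<eta>) * extr n \<le> \<Gamma> G \<and>
        induced G (high \<epsilon> n G) \<notin> \<HH>}"
      have V: "finite V" "card V = n" and HB: "H \<in> B"
        using H notin by (auto simp: V_def B_def rgraphs_on_def rgraphs_def)
      have "finite B"
        by (rule finite_subset[OF _ finite_rgraphs_with_verts[of r V]]) (auto simp: B_def)
      then have "finite (\<Gamma> ` B)" "\<Gamma> ` B \<noteq> {}" using HB by auto
      then obtain G0 where G0: "G0 \<in> B" "\<And>G. G \<in> B \<Longrightarrow> \<Gamma> G \<le> \<Gamma> G0"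
        using Max_in[of "\<Gamma> ` B"] Max_ge[of "\<Gamma> ` B"] by (metis (no_types, lifting) imageE imageI)
      define B' where "B' = {G \<in> B. \<Gamma> G = \<Gamma> G0}"
      let ?\<phi> = "\<lambda>G. card (equivalent_pairs G)"
      have "G0 \<in> B'" using G0 by (simp add: B'_def)
      moreover have "finite B'" using \<open>finite B\<close> by (simp add: B'_def)
      ultimately have "finite (?\<phi> ` B')" "?\<phi> ` B' \<noteq> {}" by blast+
      then obtain G where G: "G \<in> B'" "\<And>G'. G' \<in> B' \<Longrightarrow> ?\<phi> G' \<le> ?\<phi> G"
        using Max_in[of "?\<phi> ` B'"] Max_ge[of "?\<phi> ` B'"] by (metis (no_types, lifting) imageE imageI)
      have GB: "G \<in> B" and Gr: "G \<in> rgraphs r" "verts G = V" "(1 - \<eta>) * extr n \<le> \<Gamma> G"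
        using G by (auto simp: B'_def B_def)
      have Gn: "G \<in> rgraphs_on r n" using Gr V by (auto simp: rgraphs_on_def)
      have Gmax: "\<Gamma> G' \<le> \<Gamma> G" if "G' \<in> B" for G' using G0 G that by (auto simp: B'_def)
      have "\<not> symmetrized G"
      proof
        assume "symmetrized G"
        then have "G \<in> \<HH>" using sst Gr large[OF Gn] by (auto simp: symmetrized_stable_def)
        then have "induced G (high \<epsilon> n G) \<in> \<HH>"
          by (rule hereditaryD[OF her _ induced_in_rgraphs[OF Gr(1) high_subset] subgraph_induced[OF high_subset]])
        then show False using GB by (simp add: B_def)
      qed
      then obtain u v where uv: "uncovered G u v" "\<not> equivalent G u v" by (auto simp: symmetrized_def)
      have better: "\<exists>x y G'. uncovered G x y \<and> G' = symm G x y \<and> \<Gamma> G \<le> \<Gamma> G' \<and> G' \<notin> B"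
      proof (cases "\<Gamma> G = \<Gamma> (symm G u v) \<and> \<Gamma> G = \<Gamma> (symm G v u)")
        case True
        have "finite (verts G)" using Gr V by simp
        \<comment> \<open>Both directions keep the parameter here, so the one that moves a vertex
          into the larger class may be chosen.\<close>
        then have "?\<phi> G < ?\<phi> (symm G u v) \<or> ?\<phi> G < ?\<phi> (symm G v u)"
          using card_equivalent_pairs_symm[of G u v] card_equivalent_pairs_symm[of G v u] uv
            uncovered_commute[of G u v]
          by (metis equivalent_def nat_le_linear)
        moreover have "G' \<notin> B" if "\<Gamma> G' = \<Gamma> G" "?\<phi> G < ?\<phi> G'" for G'
        proof
          assume "G' \<in> B"
          then have "G' \<in> B'" using that(1) G(1) by (simp add: B'_def)
          then show False using G(2)[of G'] that(2) by simp
        qed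
        ultimately show ?thesis using True uv uncovered_commute[of G u v] by (metis order_refl)
      next
        case False
        then have "\<Gamma> G < \<Gamma> (symm G u v) \<or> \<Gamma> G < \<Gamma> (symm G v u)"
          using inc Gr(1) uv(1) unfolding symmetrization_increasing_def less_max_iff_disj by blast
        then show ?thesis using Gmax uv uncovered_commute[of G u v] by (meson less_imp_le not_le)
      qed
      then obtain x y G' where G': "uncovered G x y" "G' = symm G x y" "\<Gamma> G \<le> \<Gamma> G'" "G' \<notin> B" by blast
      have G'r: "G' \<in> rgraphs r" "verts G' = V" "(1 - \<eta>) * extr n \<le> \<Gamma> G'"
        using G' Gr symm_in_rgraphs[OF Gr(1) G'(1)] by auto
      then have G'n: "G' \<in> rgraphs_on r n" using V by (auto simp: rgraphs_on_def)
      have G'in: "induced G' (high \<epsilon> n G') \<in> \<HH>" using G'r G'(4) by (auto simp: B_def)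
      \<comment> \<open>Away from \<open>x\<close> the two graphs coincide, so membership in the
        family passes from \<open>G'\<close> to \<open>G\<close> on \<open>W\<close>; lying in
        \<open>high \<epsilon> n G\<close> allows growing back from \<open>W\<close>.\<close>
      define W where "W = high \<epsilon> n G \<inter> high \<epsilon> n G' - {x}"
      have "induced G W = induced G' W" using G'(2) by (simp add: W_def induced_symm)
      moreover have "induced G' W \<in> \<HH>"
      proof (rule hereditaryD[OF her G'in])
        show "induced G' W \<in> rgraphs r"
          using G'r high_subset by (intro induced_in_rgraphs) (auto simp: W_def high_def)
        show "subgraph (induced G' W) (induced G' (high \<epsilon> n G'))"
          by (intro subgraph_induced_mono) (auto simp: W_def)
      qed
      ultimately have "induced G W \<in> \<HH>" by simp
      moreover have WA: "W \<subseteq> high \<epsilon> n G" by (auto simp: W_def)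
      moreover have "(1 - \<delta>0) * real n \<le> real (card W)"
      proof -
        let ?A = "high \<epsilon> n G" let ?A' = "high \<epsilon> n G'"
        have sub: "?A \<subseteq> V" "?A' \<subseteq> V" using Gr G'r by (auto simp: high_def)
        then have fin: "finite ?A" "finite ?A'" using V finite_subset by auto
        have "card ?A + card ?A' = card (?A \<union> ?A') + card (?A \<inter> ?A')"
          using fin by (rule card_Un_Int)
        moreover have "card (?A \<union> ?A') \<le> n" using V sub card_mono[of V "?A \<union> ?A'"] by auto
        moreover have "card (?A \<inter> ?A') - 1 \<le> card W" unfolding W_def
          using fin by (simp add: card_Diff_singleton_if)
        ultimately have "real (card ?A) + real (card ?A') \<le> real n + 1 + real (card W)" by linarith
        then have "(1 - 2 * d) * real n - 1 \<le> real (card W)"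
          using large(1)[OF Gn Gr(3)] large(1)[OF G'n G'r(3)] by (simp add: algebra_simps)
        moreover have "4 * d * real n \<le> \<delta>0 * real n" using d by (intro mult_right_mono) auto
        ultimately show ?thesis using elim(4) by (simp add: algebra_simps)
      qed
      ultimately have "induced G (high \<epsilon> n G) \<in> \<HH>"
        using elim(1) Gn large(2)[OF Gn Gr(3)] WA by blast
      then show False using GB by (simp add: B_def)
    qed
    show ?case
    proof (intro ballI impI)
      fix H assume H: "H \<in> rgraphs_on r n" "(1 - \<eta>) * extr n \<le> \<Gamma> H"
      have "(1 - \<delta>) * real n \<le> (1 - d) * real n" using d by (intro mult_right_mono) auto
      then show "\<exists>W\<subseteq>verts H. (1 - \<delta>) * real n \<le> real (card W) \<and> induced H W \<in> \<HH>"
        using in_family[OF H] large[OF H] high_subset by (meson order_trans)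
    qed
  qed
  then show thesis by (rule that[OF \<eta>(1)])
qed

end

text \<open>Sum the degrees and compare with uniformity. As uniformity speaks only of positive
  graphs, positivity comes first: some degree is positive, and it is at most
  \<open>\<Gamma> H\<close> because the parameter is nonnegative after deleting the vertex.\<close>

lemma (in pos_hgraph_parameter) near_extremal_if_min_deg:
  assumes "0 < \<epsilon>" "\<epsilon> \<le> 1 / 4"
  shows "\<forall>\<^sub>F n in sequentially. \<forall>H\<in>rgraphs_on r n. (1 - \<epsilon>) * exdeg r k \<Gamma> n \<le> min_deg \<Gamma> H \<longrightarrow>
    (1 - 2 * \<epsilon>) * extr n \<le> \<Gamma> H \<and> 0 < \<Gamma> H \<and> (\<forall>v\<in>verts H. (1 - \<epsilon>) * exdeg r k \<Gamma> n \<le> deg \<Gamma> H v)"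
proof -
  obtain f where f: "f \<in> o(extr)" "\<And>n H. H \<in> rgraphs_on r n \<Longrightarrow> 0 < \<Gamma> H \<Longrightarrow>
      \<bar>(\<Sum>v\<in>verts H. deg \<Gamma> H v) - k * \<Gamma> H\<bar> \<le> f n"
    using uniform unfolding k_uniform_def by blast
  have \<epsilon>k: "0 < \<epsilon> * k" using assms k_pos by simp
  show ?thesis
    using smallo_eventually_le[OF f(1) \<epsilon>k extr_nonneg] extr_pos eventually_gt_at_top[of 0]
  proof eventually_elim
    case (elim n)
    show ?case
    proof (intro ballI impI)
      fix H assume H: "H \<in> rgraphs_on r n" "(1 - \<epsilon>) * exdeg r k \<Gamma> n \<le> min_deg \<Gamma> H"
      have V: "finite (verts H)" "card (verts H) = n" "H \<in> rgraphs r"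
        using H by (auto simp: rgraphs_on_def rgraphs_def)
      have deg: "(1 - \<epsilon>) * exdeg r k \<Gamma> n \<le> deg \<Gamma> H v" if "v \<in> verts H" for v
      proof -
        have "min_deg \<Gamma> H \<le> deg \<Gamma> H v" unfolding min_deg_def using V that by (intro Min_le) auto
        then show ?thesis using H by linarith
      qed
      obtain v where v: "v \<in> verts H" using V elim by fastforce
      have "0 < (1 - \<epsilon>) * exdeg r k \<Gamma> n" using assms k_pos elim by (simp add: exdeg_def)
      then have "0 < deg \<Gamma> H v" using deg[OF v] by linarith
      moreover have "0 \<le> \<Gamma> (del_vertex H v)"
        using V by (simp add: del_vertex_eq_induced) (intro nonneg induced_in_rgraphs, auto)
      ultimately have pos: "0 < \<Gamma> H" by (simp add: deg_def)
      have "real n * ((1 - \<epsilon>) * exdeg r k \<Gamma> n) \<le> (\<Sum>v\<in>verts H. deg \<Gamma> H v)"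
        using sum_bounded_below[of "verts H" "(1 - \<epsilon>) * exdeg r k \<Gamma> n" "deg \<Gamma> H"] deg V by simp
      moreover have "real n * ((1 - \<epsilon>) * exdeg r k \<Gamma> n) = (1 - \<epsilon>) * k * extr n"
        using elim by (simp add: exdeg_def)
      ultimately have "(1 - \<epsilon>) * k * extr n \<le> k * \<Gamma> H + \<epsilon> * k * extr n"
        using f(2)[OF H(1) pos] elim(1) by linarith
      then have "k * ((1 - 2 * \<epsilon>) * extr n) \<le> k * \<Gamma> H" by (simp add: algebra_simps)
      then have "(1 - 2 * \<epsilon>) * extr n \<le> \<Gamma> H" using k_pos by simp
      then show "(1 - 2 * \<epsilon>) * extr n \<le> \<Gamma> H \<and> 0 < \<Gamma> H \<and>
          (\<forall>v\<in>verts H. (1 - \<epsilon>) * exdeg r k \<Gamma> n \<le> deg \<Gamma> H v)"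
        using pos deg by blast
    qed
  qed
qed

section \<open>Trajectories\<close>

locale trajectory_pair = G: pos_hgraph_parameter r k \<Gamma> + Gh: hgraph_parameter r kh \<Gamma>h
  for r :: nat and k kh :: real and \<Gamma> \<Gamma>h :: "'a hgraph \<Rightarrow> real" +
  assumes traj: "trajectory r \<Gamma>h \<Gamma>"
begin

lemma extr_trajectory_le:
  assumes "0 < \<eta>"
  shows "\<forall>\<^sub>F n in sequentially. Gh.extr n \<le> (1 + \<eta>) * G.extr n"
proof -
  obtain g where g: "g \<in> o(\<lambda>_. 1)" "\<And>n. (1 - g n) * Gh.extr n \<le> G.extr n"
    using traj unfolding trajectory_def by blast
  have "0 < \<eta> / (1 + \<eta>)" using assms by simp
  from smallo_eventually_le[OF g(1) this]
  have "\<forall>\<^sub>F n in sequentially. \<bar>g n\<bar> \<le> \<eta> / (1 + \<eta>) * 1" by simp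
  then show ?thesis
  proof eventually_elim
    case (elim n)
    have "1 / (1 + \<eta>) = 1 - \<eta> / (1 + \<eta>)" using assms by (simp add: field_simps)
    also have "\<dots> \<le> 1 - g n" using elim by linarith
    finally have "1 / (1 + \<eta>) * Gh.extr n \<le> (1 - g n) * Gh.extr n"
      by (intro mult_right_mono Gh.extr_nonneg)
    then have "Gh.extr n / (1 + \<eta>) \<le> G.extr n" using g(2)[of n] by simp
    then show ?case using assms by (simp add: pos_divide_le_eq mult.commute)
  qed
qed

text \<open>The trajectory property gives \<open>H'\<close> with a value close to
  \<open>G.extr n\<close>. The extremal functions of both parameters nearly bound this value at the
  order of \<open>H'\<close>, so too few vertices would contradict \<open>extr_drop\<close>, and by
  almost monotonicity \<open>H'\<close> is also near-extremal for \<open>\<Gamma>h\<close> at its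
  own order.\<close>

lemma approximating_subgraph:
  assumes "0 < \<delta>"
  obtains \<eta> where "0 < \<eta>"
    "\<forall>\<^sub>F n in sequentially. \<forall>H\<in>rgraphs_on r n. (1 - \<eta>) * G.extr n \<le> \<Gamma> H \<longrightarrow>
      (\<exists>H'\<in>rgraphs r. subgraph H' H \<and>
        real (card (edges H)) - \<delta> * real n ^ r \<le> real (card (edges H')) \<and>
        (1 - \<delta>) * real n \<le> real (card (verts H')) \<and>
        (1 - \<delta>) * G.extr n \<le> \<Gamma>h H' \<and> (1 - \<delta>) * Gh.extr (card (verts H')) \<le> \<Gamma>h H')"
proof -
  obtain \<gamma> where \<gamma>: "0 < \<gamma>" "\<gamma> < 1" and
    drop: "\<forall>\<^sub>F n in sequentially. \<forall>m. real m \<le> (1 - \<delta>) * real n \<longrightarrow> G.extr m \<le> (1 - \<gamma>) * G.extr n"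
    using G.extr_drop[OF assms] by blast
  obtain f h where fh: "f \<in> o(\<lambda>n. real n ^ r)" "h \<in> o(G.extr)"
    "\<And>n H. H \<in> rgraphs_on r n \<Longrightarrow> 0 < \<Gamma> H \<Longrightarrow> \<exists>H'\<in>rgraphs r. subgraph H' H \<and>
       real (card (edges H)) - f n \<le> real (card (edges H')) \<and> \<Gamma> H - h n \<le> \<Gamma>h H'"
    using traj unfolding trajectory_def by blast
  \<comment> \<open>\<open>4 * \<eta> \<le> \<gamma>\<close> contradicts a small order in
    \<open>c1\<close>; \<open>5 * \<eta> \<le> \<delta>\<close> covers two factors
    \<open>1 + \<eta>\<close> and the loss \<open>2 * \<eta>\<close> in \<open>c3\<close>.\<close>
  define \<eta> where "\<eta> = min (\<gamma> / 4) (min (\<delta> / 5) (1 / 4))"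
  have \<eta>: "0 < \<eta>" "4 * \<eta> \<le> \<gamma>" "5 * \<eta> \<le> \<delta>" "\<eta> \<le> 1/4" using \<gamma> assms by (auto simp: \<eta>_def)
  obtain N where N: "\<And>n. N \<le> n \<Longrightarrow> Gh.extr n \<le> (1 + \<eta>) * G.extr n"
    using extr_trajectory_le[OF \<eta>(1)] unfolding eventually_sequentially by blast
  \<comment> \<open>The two extremal functions are comparable only from \<open>N\<close> on. Smaller
    orders of \<open>H'\<close> are excluded since its value exceeds \<open>B\<close>, by divergence
    of \<open>G.extr\<close>.\<close>
  define B where "B = Max (Gh.extr ` {..N})"
  have B: "Gh.extr n \<le> B" if "n \<le> N" for n unfolding B_def using that by (intro Max_ge) auto
  have "\<forall>\<^sub>F n in sequentially. 2 * B + 1 \<le> G.extr n"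
    using G.extr_at_top unfolding filterlim_at_top by blast
  then have "\<forall>\<^sub>F n in sequentially. \<forall>H\<in>rgraphs_on r n. (1 - \<eta>) * G.extr n \<le> \<Gamma> H \<longrightarrow>
      (\<exists>H'\<in>rgraphs r. subgraph H' H \<and>
        real (card (edges H)) - \<delta> * real n ^ r \<le> real (card (edges H')) \<and>
        (1 - \<delta>) * real n \<le> real (card (verts H')) \<and>
        (1 - \<delta>) * G.extr n \<le> \<Gamma>h H' \<and> (1 - \<delta>) * Gh.extr (card (verts H')) \<le> \<Gamma>h H')"
    using drop G.extr_pos smallo_eventually_le[OF fh(2) \<eta>(1) G.extr_nonneg]
      smallo_eventually_le[OF fh(1) assms zero_le_power[OF of_nat_0_le_iff]] G.extr_almost_mono[OF \<eta>(1)]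
  proof eventually_elim
    case (elim n)
    show ?case
    proof (intro ballI impI)
      fix H assume H: "H \<in> rgraphs_on r n" "(1 - \<eta>) * G.extr n \<le> \<Gamma> H"
      have "0 < (1 - \<eta>) * G.extr n" using \<eta> elim by simp
      then have pos: "0 < \<Gamma> H" using H by linarith
      obtain H' where H': "H' \<in> rgraphs r" "subgraph H' H"
        "real (card (edges H)) - f n \<le> real (card (edges H'))" "\<Gamma> H - h n \<le> \<Gamma>h H'"
        using fh(3)[OF H(1) pos] by blast
      let ?m = "card (verts H')"
      have mn: "?m \<le> n"
        using H H'(2) by (auto simp: rgraphs_on_def rgraphs_def subgraph_def intro: card_mono)
      have low: "(1 - 2 * \<eta>) * G.extr n \<le> \<Gamma>h H'"
        using H(2) H'(4) elim(4) by (simp add: algebra_simps)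
      have up: "\<Gamma>h H' \<le> Gh.extr ?m" using H' by (intro Gh.le_extr) (simp add: rgraphs_on_def)
      have "B < \<Gamma>h H'"
      proof -
        have "1 / 2 * G.extr n \<le> (1 - 2 * \<eta>) * G.extr n" using \<eta> by (intro mult_right_mono G.extr_nonneg) auto
        then show ?thesis using elim(1) low by linarith
      qed
      then have "N \<le> ?m" using B[of ?m] up by linarith
      then have Nm: "Gh.extr ?m \<le> (1 + \<eta>) * G.extr ?m" by (rule N)
      have c1: "(1 - \<delta>) * real n \<le> real ?m"
      proof (rule ccontr)
        assume "\<not> ?thesis"
        then have "G.extr ?m \<le> (1 - \<gamma>) * G.extr n" using elim(2) by simp
        then have "(1 + \<eta>) * G.extr ?m \<le> (1 + \<eta>) * ((1 - \<gamma>) * G.extr n)"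
          using \<eta> by (intro mult_left_mono) auto
        then have "(1 - 2 * \<eta>) * G.extr n \<le> ((1 + \<eta>) * (1 - \<gamma>)) * G.extr n"
          using low up Nm by (simp add: mult.assoc)
        then have "1 - 2 * \<eta> \<le> (1 + \<eta>) * (1 - \<gamma>)" using elim by (meson mult_le_cancel_right_pos)
        moreover have "0 < \<eta> * \<gamma>" using \<eta> \<gamma> by simp
        ultimately show False using \<eta> by (simp add: algebra_simps)
      qed
      have c2: "(1 - \<delta>) * G.extr n \<le> \<Gamma>h H'"
      proof -
        have "(1 - \<delta>) * G.extr n \<le> (1 - 2 * \<eta>) * G.extr n"
          using \<eta> by (intro mult_right_mono G.extr_nonneg) auto
        then show ?thesis using low by linarith
      qed
      have c3: "(1 - \<delta>) * Gh.extr ?m \<le> \<Gamma>h H'"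
      proof (cases "\<delta> \<le> 1")
        case True
        have "G.extr ?m \<le> (1 + \<eta>) * G.extr n" using elim mn by blast
        then have "(1 + \<eta>) * G.extr ?m \<le> (1 + \<eta>) * ((1 + \<eta>) * G.extr n)"
          using \<eta> by (intro mult_left_mono) auto
        then have "(1 - \<delta>) * Gh.extr ?m \<le> (1 - \<delta>) * ((1 + \<eta>) * ((1 + \<eta>) * G.extr n))"
          using Nm True by (intro mult_left_mono) auto
        also have "\<dots> = ((1 - \<delta>) * ((1 + \<eta>) * (1 + \<eta>))) * G.extr n" by simp
        also have "\<dots> \<le> (1 - 2 * \<eta>) * G.extr n"
        proof (intro mult_right_mono G.extr_nonneg)
          have "\<eta> * \<eta> \<le> \<eta> * 1" using \<eta> by (intro mult_left_mono) auto
          moreover have "0 \<le> \<delta> * (2 * \<eta> + \<eta> * \<eta>)" using \<eta> assms by simp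
          ultimately show "(1 - \<delta>) * ((1 + \<eta>) * (1 + \<eta>)) \<le> 1 - 2 * \<eta>"
            using \<eta>(3) by (simp add: algebra_simps)
        qed
        finally show ?thesis using low by linarith
      next
        case False
        then have "(1 - \<delta>) * Gh.extr ?m \<le> 0" using Gh.extr_nonneg by (simp add: mult_nonpos_nonneg)
        then show ?thesis using Gh.nonneg[OF H'(1)] by linarith
      qed
      show "\<exists>H'\<in>rgraphs r. subgraph H' H \<and>
        real (card (edges H)) - \<delta> * real n ^ r \<le> real (card (edges H')) \<and>
        (1 - \<delta>) * real n \<le> real (card (verts H')) \<and>
        (1 - \<delta>) * G.extr n \<le> \<Gamma>h H' \<and> (1 - \<delta>) * Gh.extr (card (verts H')) \<le> \<Gamma>h H'"
        using H' c1 c2 c3 elim(5) by (intro bexI[of _ H'] conjI) auto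
    qed
  qed
  then show thesis by (rule that[OF \<eta>(1)])
qed

text \<open>Approximate a \<open>\<Gamma>\<close>-extremal graph on \<open>n\<close> vertices: the
  result is \<open>\<Gamma>h\<close>-positive and has at least \<open>n / 2\<close> vertices, so
  arbitrarily large orders occur.\<close>

lemma extr_trajectory_frequently_pos: "\<exists>\<^sub>F n in sequentially. 0 < Gh.extr n"
  unfolding frequently_sequentially
proof
  fix N
  have half: "0 < (1 / 2 :: real)" by simp
  obtain \<eta> where \<eta>: "0 < \<eta>" and
    app: "\<forall>\<^sub>F n in sequentially. \<forall>H\<in>rgraphs_on r n. (1 - \<eta>) * G.extr n \<le> \<Gamma> H \<longrightarrow>
      (\<exists>H'\<in>rgraphs r. subgraph H' H \<and>
        real (card (edges H)) - 1 / 2 * real n ^ r \<le> real (card (edges H')) \<and>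
        (1 - 1 / 2) * real n \<le> real (card (verts H')) \<and>
        (1 - 1 / 2) * G.extr n \<le> \<Gamma>h H' \<and> (1 - 1 / 2) * Gh.extr (card (verts H')) \<le> \<Gamma>h H')"
    by (rule approximating_subgraph[OF half])
  obtain n where n: "\<forall>H\<in>rgraphs_on r n. (1 - \<eta>) * G.extr n \<le> \<Gamma> H \<longrightarrow>
      (\<exists>H'\<in>rgraphs r. subgraph H' H \<and>
        real (card (edges H)) - 1 / 2 * real n ^ r \<le> real (card (edges H')) \<and>
        (1 - 1 / 2) * real n \<le> real (card (verts H')) \<and>
        (1 - 1 / 2) * G.extr n \<le> \<Gamma>h H' \<and> (1 - 1 / 2) * Gh.extr (card (verts H')) \<le> \<Gamma>h H')"
    "0 < G.extr n" "2 * N \<le> n"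
    using eventually_happens'[OF sequentially_bot
      eventually_conj[OF app eventually_conj[OF G.extr_pos eventually_ge_at_top[of "2 * N"]]]] by blast
  obtain H where H: "H \<in> rgraphs_on r n" "\<Gamma> H = G.extr n" using G.extr_attained by blast
  have "0 \<le> \<eta> * G.extr n" using \<eta> n by simp
  then have "(1 - \<eta>) * G.extr n \<le> \<Gamma> H" using H by (simp add: algebra_simps)
  then obtain H' where H': "H' \<in> rgraphs r" "(1 - 1 / 2) * real n \<le> real (card (verts H'))"
    "(1 - 1 / 2) * G.extr n \<le> \<Gamma>h H'"
    using n(1) H(1) by blast
  have "\<Gamma>h H' \<le> Gh.extr (card (verts H'))" using H' by (intro Gh.le_extr) (simp add: rgraphs_on_def)
  then have "0 < Gh.extr (card (verts H'))" using H'(3) n(2) by simp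
  moreover have "N \<le> card (verts H')"
  proof -
    have "2 * real N \<le> real n" using n(3) by linarith
    then have "real N \<le> real (card (verts H'))" using H'(2) by simp
    then show ?thesis by simp
  qed
  ultimately show "\<exists>n\<ge>N. 0 < Gh.extr n" by blast
qed

text \<open>
  If \<open>kh \<le> 0\<close>, the average \<open>\<Gamma>h\<close>-degree of a near-extremal graph is negligible, so half of its vertices
  can be deleted at almost no cost. This contradicts the fact that halving \<open>n\<close> costs a
  constant fraction of \<open>ex_num r \<Gamma> n\<close>.
\<close>

lemma kh_pos: "0 < kh"
proof (rule ccontr)
  assume "\<not> 0 < kh"
  then have kh: "kh \<le> 0" by simp
  have half: "0 < (1 / 2 :: real)" by simp
  obtain \<gamma> where \<gamma>: "0 < \<gamma>" "\<gamma> < 1" and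
    drop: "\<forall>\<^sub>F n in sequentially. \<forall>m. real m \<le> (1 - 1 / 2) * real n \<longrightarrow> G.extr m \<le> (1 - \<gamma>) * G.extr n"
    by (rule G.extr_drop[OF half])
  \<comment> \<open>The final comparison reads
    \<open>1 - 3 * \<sigma> \<le> (1 + \<sigma>) * (1 - \<gamma>)\<close>: one
    \<open>\<sigma>\<close> is the defect of \<open>H'\<close>, two come from the deleted degrees.
    It fails as soon as \<open>4 * \<sigma> \<le> \<gamma>\<close>.\<close>
  define \<sigma> where "\<sigma> = \<gamma> / 8"
  have \<sigma>: "0 < \<sigma>" "\<sigma> \<le> 1 / 8" using \<gamma> by (auto simp: \<sigma>_def)
  obtain f where f: "f \<in> o(Gh.extr)" "\<And>n H. H \<in> rgraphs_on r n \<Longrightarrow> 0 < \<Gamma>h H \<Longrightarrow>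
      \<bar>(\<Sum>v\<in>verts H. deg \<Gamma>h H v) - kh * \<Gamma>h H\<bar> \<le> f n"
    using Gh.uniform unfolding k_uniform_def by blast
  obtain N where N: "\<And>m. N \<le> m \<Longrightarrow> Gh.extr m \<le> (1 + \<sigma>) * G.extr m"
    "\<And>m. N \<le> m \<Longrightarrow> \<bar>f m\<bar> \<le> \<sigma> * Gh.extr m"
    using eventually_conj[OF extr_trajectory_le[OF \<sigma>(1)] smallo_eventually_le[OF f(1) \<sigma>(1) Gh.extr_nonneg]]
    unfolding eventually_sequentially by auto
  obtain \<eta> where \<eta>: "0 < \<eta>" and
    app: "\<forall>\<^sub>F n in sequentially. \<forall>H\<in>rgraphs_on r n. (1 - \<eta>) * G.extr n \<le> \<Gamma> H \<longrightarrow>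
      (\<exists>H'\<in>rgraphs r. subgraph H' H \<and>
        real (card (edges H)) - \<sigma> * real n ^ r \<le> real (card (edges H')) \<and>
        (1 - \<sigma>) * real n \<le> real (card (verts H')) \<and>
        (1 - \<sigma>) * G.extr n \<le> \<Gamma>h H' \<and> (1 - \<sigma>) * Gh.extr (card (verts H')) \<le> \<Gamma>h H')"
    by (rule approximating_subgraph[OF \<sigma>(1)])
  have "\<forall>\<^sub>F n in sequentially. False"
    using app drop G.extr_pos G.extr_almost_mono[OF \<sigma>(1)] eventually_ge_at_top[of "4 * N"]
      eventually_gt_at_top[of 0]
  proof eventually_elim
    case (elim n)
    obtain H where H: "H \<in> rgraphs_on r n" "\<Gamma> H = G.extr n" using G.extr_attained by blast
    have "0 \<le> \<eta> * G.extr n" using \<eta> elim by simp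
    then have "(1 - \<eta>) * G.extr n \<le> \<Gamma> H" using H by (simp add: algebra_simps)
    then obtain H' where H': "H' \<in> rgraphs r" "subgraph H' H" "(1 - \<sigma>) * real n \<le> real (card (verts H'))"
      "(1 - \<sigma>) * G.extr n \<le> \<Gamma>h H'"
      using elim(1) H(1) by blast
    define m where "m = card (verts H')"
    \<comment> \<open>Since \<open>m\<close> lies between \<open>n / 2\<close> and \<open>n\<close>,
      this is at most \<open>n / 2\<close>, where the drop applies, and at least \<open>N\<close>
      because \<open>n\<close> is at least \<open>4 * N\<close>.\<close>
    define l where "l = m div 2"
    have H'm: "H' \<in> rgraphs_on r m" "finite (verts H')"
      using H' by (auto simp: rgraphs_on_def m_def rgraphs_def)
    have mn: "m \<le> n" unfolding m_def
      using H H'(2) by (auto simp: rgraphs_on_def rgraphs_def subgraph_def intro: card_mono)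
    have "1 / 2 * real n \<le> (1 - \<sigma>) * real n" using \<sigma> by (intro mult_right_mono) auto
    then have m: "1 / 2 * real n \<le> real m" using H'(3) by (simp add: m_def)
    have m0: "0 < real m" using m elim(6) by linarith
    have l: "N \<le> l" "l \<le> m" "real l \<le> (1 - 1 / 2) * real n" "N \<le> m"
      using m mn elim(5) by (auto simp: l_def)
    have "0 < (1 - \<sigma>) * G.extr n" using \<sigma> elim by simp
    then have pos: "0 < \<Gamma>h H'" using H'(4) by linarith
    have "kh * \<Gamma>h H' \<le> 0" using kh pos by (simp add: mult_nonpos_nonneg)
    then have sumV: "(\<Sum>v\<in>verts H'. deg \<Gamma>h H' v) \<le> \<sigma> * Gh.extr m"
      using f(2)[OF H'm(1) pos] N(2)[OF l(4)] by linarith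
    obtain X where X: "X \<subseteq> verts H'" "card X = m - l"
      "real m * (\<Sum>v\<in>X. deg \<Gamma>h H' v) \<le> real (m - l) * (\<Sum>v\<in>verts H'. deg \<Gamma>h H' v)"
      using exists_subset_sum_le_average[OF H'm(2), of "m - l"] by (auto simp: m_def)
    have "real (m - l) * (\<Sum>v\<in>verts H'. deg \<Gamma>h H' v) \<le> real (m - l) * (\<sigma> * Gh.extr m)"
      using sumV by (intro mult_left_mono) auto
    also have "\<dots> \<le> real m * (\<sigma> * Gh.extr m)"
      using \<sigma> Gh.extr_nonneg[of m] by (intro mult_right_mono) auto
    finally have "real m * (\<Sum>v\<in>X. deg \<Gamma>h H' v) \<le> real m * (\<sigma> * Gh.extr m)" using X(3) by linarith
    then have sumX: "(\<Sum>v\<in>X. deg \<Gamma>h H' v) \<le> \<sigma> * Gh.extr m" using m0 by simp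
    have "card (verts H' - X) = l"
      using X H'm l(2) by (subst card_Diff_subset) (auto simp: m_def intro: finite_subset)
    then have "\<Gamma>h (induced H' (verts H' - X)) \<le> Gh.extr l"
      using induced_in_rgraphs_on[OF H'(1), of "verts H' - X"] Gh.le_extr by auto
    then have "\<Gamma>h H' - \<sigma> * Gh.extr m \<le> Gh.extr l"
      using Gh.\<Gamma>_diff_ge[OF H'(1) pos X(1)] sumX by linarith
    also have "\<dots> \<le> (1 + \<sigma>) * G.extr l" using N l by simp
    also have "\<dots> \<le> (1 + \<sigma>) * ((1 - \<gamma>) * G.extr n)"
      using elim(2) l(3) \<sigma> by (intro mult_left_mono) auto
    finally have 1: "\<Gamma>h H' - \<sigma> * Gh.extr m \<le> (1 + \<sigma>) * ((1 - \<gamma>) * G.extr n)" .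
    have "Gh.extr m \<le> (1 + \<sigma>) * G.extr m" using N l by simp
    also have "\<dots> \<le> (1 + \<sigma>) * ((1 + \<sigma>) * G.extr n)" using elim(4) mn \<sigma> by (intro mult_left_mono) auto
    also have "\<dots> = ((1 + \<sigma>) * (1 + \<sigma>)) * G.extr n" by simp
    also have "\<dots> \<le> 2 * G.extr n"
    proof (intro mult_right_mono G.extr_nonneg)
      have "(1 + \<sigma>) * (1 + \<sigma>) \<le> (1 + 1 / 8) * (1 + 1 / 8)" using \<sigma> by (intro mult_mono) auto
      then show "(1 + \<sigma>) * (1 + \<sigma>) \<le> 2" by simp
    qed
    finally have "\<sigma> * Gh.extr m \<le> \<sigma> * (2 * G.extr n)" using \<sigma> by (intro mult_left_mono) auto
    then have "(1 - 3 * \<sigma>) * G.extr n \<le> ((1 + \<sigma>) * (1 - \<gamma>)) * G.extr n"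
      using 1 H'(4) by (simp add: algebra_simps)
    then have "1 - 3 * \<sigma> \<le> (1 + \<sigma>) * (1 - \<gamma>)" using elim by (meson mult_le_cancel_right_pos)
    moreover have "0 < \<sigma> * \<gamma>" using \<sigma> \<gamma> by simp
    ultimately show False using \<sigma>(1) by (simp add: algebra_simps \<sigma>_def)
  qed
  then show False by simp
qed

lemma pos_hgraph_parameter_trajectory: "pos_hgraph_parameter r kh \<Gamma>h"
  by unfold_locales (fact kh_pos extr_trajectory_frequently_pos)+

end

section \<open>Transfer along the trajectory\<close>

text \<open>
  The edges of \<open>H\<close> inside \<open>verts H'\<close> that meet \<open>X\<close> are added back to \<open>H'\<close>. Enlarging \<open>X\<close> by a
  vertex \<open>x\<close> only adds edges through \<open>x\<close>, which is the situation of vertex extension.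
\<close>

definition restore_at :: "'a hgraph \<Rightarrow> 'a hgraph \<Rightarrow> 'a set \<Rightarrow> 'a hgraph" where
  "restore_at H H' X = (verts H', edges H' \<union> {e \<in> edges H. e \<subseteq> verts H' \<and> e \<inter> X \<noteq> {}})"

lemma verts_restore_at [simp]: "verts (restore_at H H' X) = verts H'"
  by (simp add: restore_at_def)

lemma restore_at_in_rgraphs:
  "H \<in> rgraphs r \<Longrightarrow> H' \<in> rgraphs r \<Longrightarrow> restore_at H H' X \<in> rgraphs r"
  by (auto simp: restore_at_def rgraphs_def)

lemma subgraph_restore_at: "subgraph H' (restore_at H H' X)"
  by (auto simp: restore_at_def subgraph_def)

lemma restore_at_subgraph: "subgraph H' H \<Longrightarrow> subgraph (restore_at H H' X) H"
  by (auto simp: restore_at_def subgraph_def)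

lemma subgraph_restore_at_insert:
  "subgraph (induced (restore_at H H' (insert x X)) (W - {x})) (induced (restore_at H H' X) W)"
  by (auto simp: restore_at_def subgraph_def induced_def)

lemma induced_restore_at_empty: "induced (restore_at H H' {}) W = induced H' W"
  by (auto simp: restore_at_def induced_def)

text \<open>An edge inside \<open>W\<close> is nonempty because \<open>r\<close> is positive, hence
  meets \<open>W\<close> and is restored.\<close>

lemma induced_restore_at_self:
  assumes "H \<in> rgraphs r" "0 < r" "subgraph H' H" "W \<subseteq> verts H'"
  shows "induced (restore_at H H' W) W = induced H W"
proof -
  have "e \<inter> W \<noteq> {}" if "e \<in> edges H" "e \<subseteq> W" for e
    using that assms(1,2) by (auto simp: rgraphs_def Int_absorb2)
  then show ?thesis
    using assms(3,4) by (auto simp: restore_at_def induced_def subgraph_def)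
qed

lemma card_edges_mono:
  assumes "H \<in> rgraphs r" "subgraph H' H"
  shows "card (edges H') \<le> card (edges H)"
proof (rule card_mono)
  have "edges H \<subseteq> Pow (verts H)" "finite (verts H)" using assms(1) by (auto simp: rgraphs_def)
  then show "finite (edges H)" using finite_subset by auto
  show "edges H' \<subseteq> edges H" using assms(2) by (simp add: subgraph_def)
qed

context trajectory_pair
begin

text \<open>Continuity keeps every graph between \<open>H'\<close> and \<open>H\<close> nearly as
  large as \<open>H\<close>, hence positive, so vertex extension for \<open>\<Gamma>\<close> is
  available throughout the restoration. The assumption \<open>core\<close> is what symmetrization
  yields for \<open>\<Gamma>h\<close>.\<close>

lemma degree_stable_if_core:
  assumes r: "0 < r" and cont: "continuous_param r \<Gamma>" and her: "hereditary r \<HH>"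
    and ve: "vertex_extendable r k \<Gamma> \<HH>"
    and core: "\<And>\<delta>. 0 < \<delta> \<Longrightarrow> \<exists>\<eta>>0. \<forall>\<^sub>F n in sequentially. \<forall>H\<in>rgraphs_on r n.
      (1 - \<eta>) * Gh.extr n \<le> \<Gamma>h H \<longrightarrow>
        (\<exists>W\<subseteq>verts H. (1 - \<delta>) * real n \<le> real (card W) \<and> induced H W \<in> \<HH>)"
  shows "degree_stable r k \<Gamma> \<HH>"
proof -
  obtain \<epsilon> \<delta>V where \<epsilon>: "0 < \<epsilon>" "0 < \<delta>V" "\<delta>V < 1" and
    ext: "\<forall>\<^sub>F n in sequentially. \<forall>H\<in>rgraphs_on r n. 0 < \<Gamma> H \<longrightarrow>
       (\<forall>W S. W \<subseteq> S \<longrightarrow> S \<subseteq> G.high \<epsilon> n H \<longrightarrow> (1 - \<delta>V) * real n \<le> real (card W) \<longrightarrow>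
         induced H W \<in> \<HH> \<longrightarrow> induced H S \<in> \<HH>)"
    using G.extend_induced[OF ve] by blast
  \<comment> \<open>Shares: low-degree vertices of \<open>H'\<close>, vertices outside
    \<open>WB\<close>, and then either the single vertex being restored or the vertices of
    \<open>H\<close> missing from \<open>H'\<close>.\<close>
  define d where "d = \<delta>V / 4"
  have d: "0 < d" "d < 1 / 4" "4 * d = \<delta>V" using \<epsilon> by (auto simp: d_def)
  obtain \<eta>B where \<eta>B: "0 < \<eta>B" and
    coreB: "\<forall>\<^sub>F n in sequentially. \<forall>H\<in>rgraphs_on r n. (1 - \<eta>B) * Gh.extr n \<le> \<Gamma>h H \<longrightarrow>
        (\<exists>W\<subseteq>verts H. (1 - d) * real n \<le> real (card W) \<and> induced H W \<in> \<HH>)"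
    using core[OF d(1)] by blast
  obtain \<eta>C where \<eta>C: "0 < \<eta>C" and
    coreC: "\<forall>\<^sub>F n in sequentially. \<forall>H\<in>rgraphs_on r n. (1 - \<eta>C) * G.extr n \<le> \<Gamma> H \<longrightarrow>
        (1 - d) * real n \<le> real (card (G.high \<epsilon> n H))"
    using G.card_high_ge[OF \<epsilon>(1) d(1)] by blast
  define c where "c = min \<eta>C 1"
  have c: "0 < c" "c \<le> 1" "c \<le> \<eta>C" using \<eta>C by (auto simp: c_def)
  then have c4: "0 < c / 4" by simp
  then obtain \<delta>c N1 where \<delta>c: "0 < \<delta>c"
    "\<And>n H H'. N1 \<le> n \<Longrightarrow> H \<in> rgraphs_on r n \<Longrightarrow> H' \<in> rgraphs r \<Longrightarrow> subgraph H' H \<Longrightarrow>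
       real (card (edges H)) - \<delta>c * real n ^ r \<le> real (card (edges H')) \<Longrightarrow>
       \<Gamma> H - c / 4 * G.extr n \<le> \<Gamma> H'"
    using cont unfolding continuous_param_def by metis
  define \<delta>T where "\<delta>T = min d (min \<delta>c \<eta>B)"
  have \<delta>T: "0 < \<delta>T" "\<delta>T \<le> d" "\<delta>T \<le> \<delta>c" "\<delta>T \<le> \<eta>B" using d \<delta>c \<eta>B by (auto simp: \<delta>T_def)
  obtain \<eta>T where \<eta>T: "0 < \<eta>T" and
    app: "\<forall>\<^sub>F n in sequentially. \<forall>H\<in>rgraphs_on r n. (1 - \<eta>T) * G.extr n \<le> \<Gamma> H \<longrightarrow>
      (\<exists>H'\<in>rgraphs r. subgraph H' H \<and>
        real (card (edges H)) - \<delta>T * real n ^ r \<le> real (card (edges H')) \<and>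
        (1 - \<delta>T) * real n \<le> real (card (verts H')) \<and>
        (1 - \<delta>T) * G.extr n \<le> \<Gamma>h H' \<and> (1 - \<delta>T) * Gh.extr (card (verts H')) \<le> \<Gamma>h H')"
    using approximating_subgraph[OF \<delta>T(1)] by blast
  \<comment> \<open>The bounds serve, in turn, to make every vertex of \<open>H\<close> high, to
    make \<open>H\<close> near-extremal enough for the trajectory, and to keep
    \<open>2 * \<epsilon>' + c / 4 \<le> c / 2\<close> after the continuity loss.\<close>
  define \<epsilon>' where "\<epsilon>' = min (min \<epsilon> (\<eta>T / 2)) (c / 8)"
  have \<epsilon>': "0 < \<epsilon>'" "\<epsilon>' \<le> \<epsilon>" "2 * \<epsilon>' \<le> \<eta>T" "8 * \<epsilon>' \<le> c" "\<epsilon>' \<le> 1 / 4"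
    using \<epsilon> \<eta>T c by (auto simp: \<epsilon>'_def)
  obtain N2 where N2: "\<And>m H W S. N2 \<le> m \<Longrightarrow> H \<in> rgraphs_on r m \<Longrightarrow> 0 < \<Gamma> H \<Longrightarrow> W \<subseteq> S \<Longrightarrow>
      S \<subseteq> G.high \<epsilon> m H \<Longrightarrow> (1 - \<delta>V) * real m \<le> real (card W) \<Longrightarrow> induced H W \<in> \<HH> \<Longrightarrow> induced H S \<in> \<HH>"
    "\<And>m H. N2 \<le> m \<Longrightarrow> H \<in> rgraphs_on r m \<Longrightarrow> (1 - \<eta>B) * Gh.extr m \<le> \<Gamma>h H \<Longrightarrow>
        \<exists>W\<subseteq>verts H. (1 - d) * real m \<le> real (card W) \<and> induced H W \<in> \<HH>"
    "\<And>m H. N2 \<le> m \<Longrightarrow> H \<in> rgraphs_on r m \<Longrightarrow> (1 - \<eta>C) * G.extr m \<le> \<Gamma> H \<Longrightarrow>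
        (1 - d) * real m \<le> real (card (G.high \<epsilon> m H))"
    "\<And>m. N2 \<le> m \<Longrightarrow> 1 \<le> d * real m"
  proof -
    obtain Ne where Ne: "\<forall>m\<ge>Ne. \<forall>H\<in>rgraphs_on r m. 0 < \<Gamma> H \<longrightarrow>
       (\<forall>W S. W \<subseteq> S \<longrightarrow> S \<subseteq> G.high \<epsilon> m H \<longrightarrow> (1 - \<delta>V) * real m \<le> real (card W) \<longrightarrow>
         induced H W \<in> \<HH> \<longrightarrow> induced H S \<in> \<HH>)"
      using ext unfolding eventually_sequentially ..
    obtain Nb where Nb: "\<forall>m\<ge>Nb. \<forall>H\<in>rgraphs_on r m. (1 - \<eta>B) * Gh.extr m \<le> \<Gamma>h H \<longrightarrow>
        (\<exists>W\<subseteq>verts H. (1 - d) * real m \<le> real (card W) \<and> induced H W \<in> \<HH>)"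
      using coreB unfolding eventually_sequentially ..
    obtain Nc where Nc: "\<forall>m\<ge>Nc. \<forall>H\<in>rgraphs_on r m. (1 - \<eta>C) * G.extr m \<le> \<Gamma> H \<longrightarrow>
        (1 - d) * real m \<le> real (card (G.high \<epsilon> m H))"
      using coreC unfolding eventually_sequentially ..
    obtain Nd where Nd: "\<forall>m\<ge>Nd. 1 \<le> d * real m"
      using eventually_le_mult_nat[OF d(1), of 1] unfolding eventually_sequentially ..
    show thesis
    proof (rule that[of "max (max Ne Nb) (max Nc Nd)"], goal_cases)
      case (1 m H W S)
      then show ?case using Ne[rule_format, of m] by simp
    next
      case (2 m H)
      then show ?case using Nb[rule_format, of m] by simp
    next
      case (3 m H)
      then show ?case using Nc[rule_format, of m] by simp
    next
      case (4 m)
      then show ?case using Nd[rule_format, of m] by simp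
    qed
  qed
  have d': "0 < 1 - d" using d by simp
  have "\<forall>\<^sub>F n in sequentially. \<forall>H\<in>rgraphs_on r n.
      (1 - \<epsilon>') * exdeg r k \<Gamma> n \<le> min_deg \<Gamma> H \<longrightarrow> H \<in> \<HH>"
    using app G.near_extremal_if_min_deg[OF \<epsilon>'(1,5)] G.extr_almost_mono[OF c4] G.extr_pos
      eventually_le_mult_nat[OF d', of N2] eventually_ge_at_top[of N1] eventually_ge_at_top[of N2]
  proof eventually_elim
    case (elim n)
    show ?case
    proof (intro ballI impI)
      fix H assume H: "H \<in> rgraphs_on r n" "(1 - \<epsilon>') * exdeg r k \<Gamma> n \<le> min_deg \<Gamma> H"
      have Hr: "H \<in> rgraphs r" using H by (simp add: rgraphs_on_def)
      have Hdeg: "(1 - 2 * \<epsilon>') * G.extr n \<le> \<Gamma> H" "0 < \<Gamma> H"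
        "\<And>v. v \<in> verts H \<Longrightarrow> (1 - \<epsilon>') * exdeg r k \<Gamma> n \<le> deg \<Gamma> H v"
        using elim(2) H by blast+
      have "(1 - \<eta>T) * G.extr n \<le> (1 - 2 * \<epsilon>') * G.extr n"
        using \<epsilon>' by (intro mult_right_mono G.extr_nonneg) auto
      then have "(1 - \<eta>T) * G.extr n \<le> \<Gamma> H" using Hdeg(1) by linarith
      then obtain H' where H': "H' \<in> rgraphs r" "subgraph H' H"
        "real (card (edges H)) - \<delta>T * real n ^ r \<le> real (card (edges H'))"
        "(1 - \<delta>T) * real n \<le> real (card (verts H'))"
        "(1 - \<delta>T) * Gh.extr (card (verts H')) \<le> \<Gamma>h H'"
        using elim(1) H(1) by blast
      define m where "m = card (verts H')"
      have H'm: "H' \<in> rgraphs_on r m" "finite (verts H')"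
        using H' by (auto simp: rgraphs_on_def m_def rgraphs_def)
      have mn: "m \<le> n" unfolding m_def
        using H H'(2) by (auto simp: rgraphs_on_def rgraphs_def subgraph_def intro: card_mono)
      have "(1 - d) * real n \<le> (1 - \<delta>T) * real n" using \<delta>T by (intro mult_right_mono) auto
      then have m: "(1 - d) * real n \<le> real m" using H'(4) by (simp add: m_def)
      then have N2m: "N2 \<le> m" using elim(5) by linarith
      have loss: "\<Gamma> H - c / 4 * G.extr n \<le> \<Gamma> K"
        if K: "K \<in> rgraphs r" "subgraph K H" "subgraph H' K" for K
      proof (rule \<delta>c(2)[OF elim(6) H(1) K(1,2)])
        have "\<delta>T * real n ^ r \<le> \<delta>c * real n ^ r" using \<delta>T by (intro mult_right_mono) auto
        then show "real (card (edges H)) - \<delta>c * real n ^ r \<le> real (card (edges K))"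
          using H'(3) card_edges_mono[OF K(1,3)] by linarith
      qed
      have pos: "0 < \<Gamma> K" if K: "K \<in> rgraphs r" "subgraph K H" "subgraph H' K" for K
      proof -
        have "0 < (1 - 2 * \<epsilon>' - c / 4) * G.extr n" using \<epsilon>' c elim by simp
        then show ?thesis using loss[OF K] Hdeg(1) by (simp add: algebra_simps)
      qed
      have "(1 - \<eta>C) * G.extr m \<le> (1 - c) * G.extr m"
        using c by (intro mult_right_mono G.extr_nonneg) auto
      also have "\<dots> \<le> (1 - c) * ((1 + c / 4) * G.extr n)"
        using elim(3) mn c by (intro mult_left_mono) auto
      also have "\<dots> = ((1 - c) * (1 + c / 4)) * G.extr n" by simp
      also have "\<dots> \<le> (1 - 2 * \<epsilon>' - c / 4) * G.extr n"
      proof (intro mult_right_mono G.extr_nonneg)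
        have "0 \<le> c * c" by simp
        moreover have "(1 - c) * (1 + c / 4) = 1 - 3 * c / 4 - c * c / 4" by (simp add: field_simps)
        ultimately show "(1 - c) * (1 + c / 4) \<le> 1 - 2 * \<epsilon>' - c / 4" using \<epsilon>' c by linarith
      qed
      also have "\<dots> \<le> \<Gamma> H'"
        using loss[OF H'(1,2)] Hdeg(1) by (simp add: algebra_simps subgraph_def)
      finally have "(1 - \<eta>C) * G.extr m \<le> \<Gamma> H'" .
      then have highC: "(1 - d) * real m \<le> real (card (G.high \<epsilon> m H'))"
        by (rule N2(3)[OF N2m H'm(1)])
      have "(1 - \<eta>B) * Gh.extr m \<le> (1 - \<delta>T) * Gh.extr m"
        using \<delta>T by (intro mult_right_mono Gh.extr_nonneg) auto
      then have "(1 - \<eta>B) * Gh.extr m \<le> \<Gamma>h H'" using H'(5) by (simp add: m_def)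
      then obtain WB where WB: "WB \<subseteq> verts H'" "(1 - d) * real m \<le> real (card WB)" "induced H' WB \<in> \<HH>"
        using N2(2)[OF N2m H'm(1)] by blast
      define W where "W = G.high \<epsilon> m H' \<inter> WB"
      have W: "W \<subseteq> verts H'" "W \<subseteq> G.high \<epsilon> m H'" "W \<subseteq> WB" "finite W"
        using WB(1) H'm by (auto simp: W_def intro: finite_subset)
      have cardW: "(1 - 2 * d) * real m \<le> real (card W)"
      proof -
        have sub: "G.high \<epsilon> m H' \<subseteq> verts H'" by (rule G.high_subset)
        then have fin: "finite (G.high \<epsilon> m H')" "finite WB" using WB H'm finite_subset by auto
        have "card (G.high \<epsilon> m H') + card WB = card (G.high \<epsilon> m H' \<union> WB) + card W"
          unfolding W_def using fin by (rule card_Un_Int)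
        moreover have "card (G.high \<epsilon> m H' \<union> WB) \<le> m"
          using card_mono[OF H'm(2) Un_least[OF sub WB(1)]] by (simp add: m_def)
        ultimately show ?thesis using highC WB(2) by (simp add: algebra_simps)
      qed
      have start: "induced H' W \<in> \<HH>"
        by (rule hereditaryD[OF her WB(3) induced_in_rgraphs[OF H'(1) W(1)] subgraph_induced_mono[OF W(3)]])
      have "induced (restore_at H H' X) W \<in> \<HH>" if "finite X" "X \<subseteq> W" for X
        using that
      proof (induction X rule: finite_induct)
        case empty
        then show ?case using start by (simp add: induced_restore_at_empty)
      next
        case (insert x X)
        let ?K = "restore_at H H' (insert x X)"
        have K: "?K \<in> rgraphs r" "subgraph ?K H" "subgraph H' ?K"
          using restore_at_in_rgraphs[OF Hr H'(1)] restore_at_subgraph[OF H'(2)] subgraph_restore_at by blast+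
        have Km: "?K \<in> rgraphs_on r m" using K by (simp add: rgraphs_on_def m_def)
        have Kpos: "0 < \<Gamma> ?K" by (rule pos[OF K])
        \<comment> \<open>Local monotonicity carries large degree from \<open>H'\<close> to every
          restored graph, so a single set \<open>W\<close> works for all of them.\<close>
        have "deg \<Gamma> H' v \<le> deg \<Gamma> ?K v" if "v \<in> verts H'" for v
          using G.monotone K Kpos H'(1) that unfolding locally_monotone_def by blast
        then have high: "W \<subseteq> G.high \<epsilon> m ?K" using W(2) by (force simp: G.high_def)
        show ?case
        proof (rule N2(1)[OF N2m Km Kpos _ high])
          show "W - {x} \<subseteq> W" by blast
          have "card W \<le> card (W - {x}) + 1" using W(4) card_Suc_Diff1[of W x] by (cases "x \<in> W") auto
          then have "(1 - 2 * d) * real m - 1 \<le> real (card (W - {x}))" using cardW by linarith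
          then show "(1 - \<delta>V) * real m \<le> real (card (W - {x}))"
            using N2(4)[OF N2m] d(3)[symmetric] by (simp add: algebra_simps)
          have "induced ?K (W - {x}) \<in> rgraphs r" using K(1) W(1) by (intro induced_in_rgraphs) auto
          moreover have "induced (restore_at H H' X) W \<in> \<HH>" using insert by simp
          ultimately show "induced ?K (W - {x}) \<in> \<HH>"
            using hereditaryD[OF her _ _ subgraph_restore_at_insert] by blast
        qed
      qed
      then have "induced (restore_at H H' W) W \<in> \<HH>" using W(4) by blast
      then have HW: "induced H W \<in> \<HH>" using induced_restore_at_self[OF Hr r H'(2) W(1)] by simp
      have WH: "W \<subseteq> verts H" using W(1) H'(2) by (auto simp: subgraph_def)
      have "(1 - \<epsilon>) * exdeg r k \<Gamma> n \<le> (1 - \<epsilon>') * exdeg r k \<Gamma> n"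
        using \<epsilon>' by (intro mult_right_mono G.exdeg_nonneg) auto
      \<comment> \<open>Here the minimum degree hypothesis acts on single vertices: \<open>W\<close>
        can be extended to all of \<open>verts H\<close>, including vertices outside
        \<open>H'\<close>.\<close>
      then have allhigh: "verts H \<subseteq> G.high \<epsilon> n H" using Hdeg(3) by (force simp: G.high_def)
      have "induced H (verts H) \<in> \<HH>"
      proof (rule N2(1)[OF elim(7) H(1) Hdeg(2) WH allhigh _ HW])
        have "(1 - 2 * d) * ((1 - d) * real n) \<le> (1 - 2 * d) * real m"
          using m d by (intro mult_left_mono) auto
        moreover have "(1 - \<delta>V) * real n \<le> ((1 - 2 * d) * (1 - d)) * real n"
        proof (intro mult_right_mono)
          have "0 \<le> d * d" by simp
          moreover have "(1 - 2 * d) * (1 - d) = 1 - 3 * d + 2 * (d * d)" by (simp add: algebra_simps)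
          ultimately show "1 - \<delta>V \<le> (1 - 2 * d) * (1 - d)" using d by linarith
        qed simp
        ultimately show "(1 - \<delta>V) * real n \<le> real (card W)" using cardW by (simp add: mult.assoc)
      qed
      then show "H \<in> \<HH>" by (simp add: induced_all_verts[OF Hr])
    qed
  qed
  then show ?thesis unfolding degree_stable_def eventually_sequentially using \<epsilon>'(1) by blast
qed

end

theorem theorem1p8:
  fixes r :: nat and k kh :: real
    and \<Gamma> \<Gamma>h :: "'a hgraph \<Rightarrow> real" and \<HH> :: "'a hgraph set"
  assumes "r \<ge> 2"
    and "\<forall>H\<in>rgraphs r. \<Gamma> H \<ge> 0" and "\<forall>H\<in>rgraphs r. \<Gamma>h H \<ge> 0"
    and "attains_max r \<Gamma>" and "attains_max r \<Gamma>h"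
    and "k_uniform r k \<Gamma>" and "smooth r k \<Gamma>" and "locally_lipschitz r k \<Gamma>"
    and "continuous_param r \<Gamma>" and "locally_monotone r \<Gamma>"
    and "k_uniform r kh \<Gamma>h" and "smooth r kh \<Gamma>h" and "locally_lipschitz r kh \<Gamma>h"
    and "continuous_param r \<Gamma>h" and "locally_monotone r \<Gamma>h"
    and "\<exists>\<^sub>F n in sequentially. exdeg r k \<Gamma> n > 0"
    and "hereditary r \<HH>"
    and "trajectory r \<Gamma>h \<Gamma>"
    and "symmetrization_increasing r \<Gamma>h"
    and "symmetrized_stable r \<Gamma>h \<HH>"
    and "vertex_extendable r kh \<Gamma>h \<HH>" and "vertex_extendable r k \<Gamma> \<HH>"
  shows "degree_stable r k \<Gamma> \<HH>"
proof -
  interpret G: hgraph_parameter r k \<Gamma>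
    by (intro hgraph_parameter.intro assms(2)[rule_format] assms)
  interpret Gh: hgraph_parameter r kh \<Gamma>h
    by (intro hgraph_parameter.intro assms(3)[rule_format] assms)
  \<comment> \<open>As \<open>extr\<close> is nonnegative, one positive value of
    \<open>exdeg\<close> fixes the sign of \<open>k\<close>.\<close>
  have exdeg_pos: "0 < k \<and> 0 < G.extr n" if "0 < exdeg r k \<Gamma> n" for n
    using that G.extr_nonneg[of n] unfolding exdeg_def
    by (auto simp: zero_less_divide_iff zero_less_mult_iff)
  have "0 < k" using frequently_ex[OF assms(16)] exdeg_pos by blast
  moreover have "\<exists>\<^sub>F n in sequentially. 0 < G.extr n"
    using assms(16) by (rule frequently_elim1) (use exdeg_pos in blast)
  ultimately interpret trajectory_pair r k kh \<Gamma> \<Gamma>h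
    using assms(18) by unfold_locales
  interpret P: pos_hgraph_parameter r kh \<Gamma>h
    by (rule pos_hgraph_parameter_trajectory)
  show ?thesis
  proof (rule degree_stable_if_core)
    fix \<delta> :: real assume "0 < \<delta>"
    with assms(17,19-21) obtain \<eta> where "0 < \<eta>"
      "\<forall>\<^sub>F n in sequentially. \<forall>H\<in>rgraphs_on r n. (1 - \<eta>) * Gh.extr n \<le> \<Gamma>h H \<longrightarrow>
        (\<exists>W\<subseteq>verts H. (1 - \<delta>) * real n \<le> real (card W) \<and> induced H W \<in> \<HH>)"
      by (rule P.near_extremal_core)
    then show "\<exists>\<eta>>0. \<forall>\<^sub>F n in sequentially. \<forall>H\<in>rgraphs_on r n.
      (1 - \<eta>) * Gh.extr n \<le> \<Gamma>h H \<longrightarrow>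
        (\<exists>W\<subseteq>verts H. (1 - \<delta>) * real n \<le> real (card W) \<and> induced H W \<in> \<HH>)"
      by blast
  qed (use assms(1) in simp, fact+)
qed

end
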